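(* Consider a ring network whose agents know that $n\sim\sigma$, where $\sigma$ is the uniform prior on the integers of an interval $[\alpha,\beta]$. Then the protocol "Knowledge Sharing in a Ring" (described in the context) is a distributed equilibrium for $2$-Knowledge Sharing for any $\alpha,\beta$.
   Context: **Network and agents.** The network is a bidirectional ring with $n$ nodes ($n$ always denotes the actual number of nodes), with a global orientation. Each node is an agent with unlimited computational power. Agents communicate over edges in synchronous rounds and all start at round $0$. Initially each agent knows its own id and private input (including its preference), but not those of other agents. Private information comes from a finite set, and each agent's prior over the private information of the others is uniform. The agents do not know $n$ but know its prior $\sigma$. *Uniform prior on $[\alpha,\beta]$*: $\Pr[n\le t]=\frac{t-\alpha+1}{\beta-\alpha+1}$ for integers $\alpha\le t\le\beta$. **Outputs and utilities.** Agent $a$ outputs $o_a$ ($\bot$ means it aborts). Output vectors are $O=(o_1,\dots,o_n)\in\Theta=\Theta_L\sqcup\Theta_E$, where $\Theta_L$ is the set of legal and $\Theta_E$ the set of erroneous output vectors. Each agent $a$ has a single preferred output value $p_a$ and utility $u_a(O)=1$ if $o_a=p_a$ and $O\in\Theta_L$, and $u_a(O)=0$ otherwise. An agent that detects that another agent deviated outputs $\bot$, which makes the output erroneous. **Equilibrium.** For a step $s$ (the entire operation of an agent in one round) of agent $a$ at round $r$ of an execution, $\mathbb{E}_{s,r}[u_a]=\sum_{O\in\Theta}x_O(s,r)u_a(O)$, where $x_O(s,r)$ is the probability, estimated by $a$ at round $r$, that $O$ is output if $a$ takes step $s$ and all other agents follow the algorithm. An algorithm $\Lambda$ whose next step at round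 $r$ is $s(r)$ is a (distributed) equilibrium if for every agent $a$, every round $r$ of every possible execution in which all steps up to round $r$ were according to $\Lambda$, and every deviating step $\bar s$: $\mathbb{E}_{s(r),r}[u_a]\ge \mathbb{E}_{\bar s,r}[u_a]$. Only a single agent deviates (no coalitions). **Duplication (Sybil attack).** A deviating agent may pretend to be $d$ agents, by simulating $d$ imaginary agents with fake ids and distributing its edges among them. The other agents then execute the algorithm as if on the enlarged ring, of size $n'=n+d-1$. Fake id collisions are disregarded. The cheater still produces a single output, and legality is judged on the output vector of the $n$ real agents. The number $d$ is decided at round $0$, before Wake-Up is completed. If $n'=d+n-1>\beta$, the duplication is detected and the output is erroneous. **$k$-Knowledge Sharing.** Each agent $a$ has a private input $i_a$; all agents have the same function $q$ with $|\mathrm{range}(q)|=k$, where $k$ and the output space are known to all agents. An output vector is legal iff all agents output the same value $\neq\bot$. The output is correct if every agent outputs $q(I)$, with $I$ the inputs of all agents. The function $q$ satisfies the Full Knowledge property: for any number $m$ of inputs, any $1\le j\le m$ and any fixed $(x_1,\dots,x_{j-1},x_{j+1},\dots,x_m)$, the number $|\{x_j : q(x_1,\dots,x_m)=y\}|$ is the same for every $y$ in the range of $q$ (inputs being uniform). Each agent $a$ prefers a certain output value $p_a$. **Secret-Transmit$(i_a,r,b)$.** Agent $a$ selects a random number $R_a$ and sets $X_a=R_a\oplus i_a$. It sends $R_a$ clockwise and $X_a$ counter-clockwise, each being forwarded until it reaches the agent just before $b$. At round $r-1$ the two neighbors of $b$ simultaneously send these two values to $b$, so $b$ learns $i_a$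 at round $r$. **Protocol "Knowledge Sharing in a Ring".** (1) All agents execute Wake-Up, a preliminary phase after which every agent knows the ids of all agents and the size $n'$ of the ring (possibly including duplicated agents). (2) For each agent $a$ let $b^1_a$ be the clockwise neighbor of $a$ and $b^2_a$ the agent at distance $\lfloor n'/2\rfloor$ counter-clockwise from $a$. (3) Each agent $a$ simultaneously performs Secret-Transmit$(i_a,n',b^1_a)$ and Secret-Transmit$(i_a,n',b^2_a)$. (4) At round $n'+1$ each agent sends its input around the ring. (5) At round $2n'$ each agent outputs $q(I)$. *)

theory Defs
  imports "HOL-Probability.Probability"
begin

section \<open>Algorithms on a ring and their executions\<close>

text \<open>
  The deviating (or potentially deviating) agent is called \<open>a\<close>.  Nodes of the ring are numbered
  clockwise from \<open>a\<close>, which is node 0; since the ring has no distinguished node and \<open>a\<close> knows only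
  its own private information, this numbering carries no information.
\<close>

text \<open>Directions in which a message travels.\<close>

datatype direction = Cw | Ccw

text \<open>The node from which node \<open>k\<close> receives the messages travelling in a given direction.\<close>

fun upstream :: "nat \<Rightarrow> direction \<Rightarrow> nat \<Rightarrow> nat" where
  "upstream n Cw k = (k + n - 1) mod n"
| "upstream n Ccw k = (k + 1) mod n"

text \<open>
  The \<open>t\<close>-th entry (from 0) of a history holds what arrived at round \<open>t + 2\<close>, that is, what was
  sent at round \<open>t + 1\<close>.  So the step of round \<open>t \<ge> 1\<close> is taken on a history of length \<open>t - 1\<close>.
\<close>

type_synonym 'm history = "(direction \<Rightarrow> 'm) list"

text \<open>
  Wake-Up is round 0 and enters through its outcome: every agent obtains the list of the
  ids on the (possibly enlarged) ring, clockwise and starting with its own id.  This list, the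
  private input and the coins (drawn in the step of round 1) are the first three arguments of the
  functions below.  The outputs are produced at round \<open>last_round n'\<close>, where \<open>n'\<close> is the length of
  the list.  \<open>None\<close> stands for the output \<open>\<bottom>\<close>.
\<close>

record ('x, 'c, 'm, 'y) algorithm =
  alg_send :: "nat list \<Rightarrow> 'x \<Rightarrow> 'c \<Rightarrow> 'm history \<Rightarrow> direction \<Rightarrow> 'm"
  alg_output :: "nat list \<Rightarrow> 'x \<Rightarrow> 'c \<Rightarrow> 'm history \<Rightarrow> 'y option"
  last_round :: "nat \<Rightarrow> nat"

text \<open>Everything random in an execution; entry \<open>k\<close> of each list belongs to node \<open>k\<close>.\<close>

record ('x, 'c, 'y) world =
  ids :: "nat list"
  inputs :: "'x list"
  prefs :: "'y list"
  coins :: "'c list"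

abbreviation ring_size :: "('x, 'c, 'y) world \<Rightarrow> nat" where
  "ring_size w \<equiv> length (ids w)"

text \<open>\<open>U\<close> is the finite space of (real) ids and \<open>Y\<close> the set of possible preferences.\<close>

definition worlds :: "nat set \<Rightarrow> 'y set \<Rightarrow> nat \<Rightarrow> ('x, 'c, 'y) world set" where
  "worlds U Y n = {w. length (ids w) = n \<and> distinct (ids w) \<and> set (ids w) \<subseteq> U \<and>
     length (inputs w) = n \<and> length (prefs w) = n \<and> set (prefs w) \<subseteq> Y \<and> length (coins w) = n}"

definition prior :: "nat set \<Rightarrow> 'y set \<Rightarrow> nat pmf \<Rightarrow> ('x, 'c, 'y) world pmf" where
  "prior U Y \<sigma> = bind_pmf \<sigma> (\<lambda>n. pmf_of_set (worlds U Y n))"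

text \<open>
  The behaviour of \<open>a\<close>.  \<open>names\<close> are the ids, in clockwise order, of the \<open>d = length names\<close> agents
  that \<open>a\<close> presents in Wake-Up; \<open>d = 1\<close> means that there is no duplication.  The simulated
  agents form an arc of the enlarged ring, whose two ends get the two edges of \<open>a\<close>.  As
  \<open>a\<close> may invent whatever happens inside the arc, only the traffic on these two edges is modelled.
  The first argument of \<open>str_send\<close> and \<open>str_output\<close> is the enlarged ring, starting with \<open>names\<close>.
\<close>

record ('m, 'y) strategy =
  names :: "nat list"
  str_send :: "nat list \<Rightarrow> 'm history \<Rightarrow> direction \<Rightarrow> 'm"
  str_output :: "nat list \<Rightarrow> 'm history \<Rightarrow> 'y option"

definition follow :: "('x, 'c, 'm, 'y) algorithm \<Rightarrow> ('x, 'c, 'y) world \<Rightarrow> ('m, 'y) strategy" where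
  "follow \<Lambda> w = \<lparr>names = [ids w ! 0],
     str_send = (\<lambda>R. alg_send \<Lambda> R (inputs w ! 0) (coins w ! 0)),
     str_output = (\<lambda>R. alg_output \<Lambda> R (inputs w ! 0) (coins w ! 0))\<rparr>"

text \<open>
  Take the steps of \<open>s\<close> before round \<open>r\<close> and those of \<open>s'\<close> from round \<open>r\<close> on.  It is
  used only for \<open>r\<close> up to the round of the output, which therefore is always that of \<open>s'\<close>.
\<close>

definition switch :: "nat \<Rightarrow> ('m, 'y) strategy \<Rightarrow> ('m, 'y) strategy \<Rightarrow> ('m, 'y) strategy" where
  "switch r s s' = \<lparr>names = (if r = 0 then names s' else names s),
     str_send = (\<lambda>R h. if length h + 1 < r then str_send s R h else str_send s' R h),
     str_output = str_output s'\<rparr>"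

definition enlarged_ring :: "('x, 'c, 'y) world \<Rightarrow> ('m, 'y) strategy \<Rightarrow> nat list" where
  "enlarged_ring w s = names s @ tl (ids w)"

text \<open>The enlarged ring as seen from the honest node \<open>k \<ge> 1\<close>.\<close>

definition seen_from :: "('x, 'c, 'y) world \<Rightarrow> ('m, 'y) strategy \<Rightarrow> nat \<Rightarrow> nat list" where
  "seen_from w s k = rotate (length (names s) + k - 1) (enlarged_ring w s)"

definition node_send ::
  "('x, 'c, 'm, 'y) algorithm \<Rightarrow> ('x, 'c, 'y) world \<Rightarrow> ('m, 'y) strategy \<Rightarrow>
   nat \<Rightarrow> 'm history \<Rightarrow> direction \<Rightarrow> 'm" where
  "node_send \<Lambda> w s k = (if k = 0 then str_send s (enlarged_ring w s)
     else alg_send \<Lambda> (seen_from w s k) (inputs w ! k) (coins w ! k))"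

definition node_output ::
  "('x, 'c, 'm, 'y) algorithm \<Rightarrow> ('x, 'c, 'y) world \<Rightarrow> ('m, 'y) strategy \<Rightarrow>
   nat \<Rightarrow> 'm history \<Rightarrow> 'y option" where
  "node_output \<Lambda> w s k = (if k = 0 then str_output s (enlarged_ring w s)
     else alg_output \<Lambda> (seen_from w s k) (inputs w ! k) (coins w ! k))"

text \<open>What node \<open>k\<close> has received of the messages sent at rounds \<open>1, \<dots>, t\<close>.\<close>

primrec received ::
  "('x, 'c, 'm, 'y) algorithm \<Rightarrow> ('x, 'c, 'y) world \<Rightarrow> ('m, 'y) strategy \<Rightarrow>
   nat \<Rightarrow> nat \<Rightarrow> 'm history" where
  "received \<Lambda> w s 0 = (\<lambda>k. [])"
| "received \<Lambda> w s (Suc t) = (\<lambda>k. received \<Lambda> w s t k @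
     [\<lambda>D. let j = upstream (ring_size w) D k in node_send \<Lambda> w s j (received \<Lambda> w s t j) D])"

text \<open>The output vector of the real agents.\<close>

definition outcome ::
  "('x, 'c, 'm, 'y) algorithm \<Rightarrow> ('x, 'c, 'y) world \<Rightarrow> ('m, 'y) strategy \<Rightarrow> 'y option list" where
  "outcome \<Lambda> w s = map (\<lambda>k. node_output \<Lambda> w s k
     (received \<Lambda> w s (last_round \<Lambda> (length (enlarged_ring w s)) - 1) k)) [0..<ring_size w]"


section \<open>Utilities and equilibria\<close>

definition legal :: "'y option list \<Rightarrow> bool" where
  "legal out \<longleftrightarrow> (\<exists>y. \<forall>x \<in> set out. x = Some y)"

definition utility :: "'y \<Rightarrow> 'y option list \<Rightarrow> real" where
  "utility p out = (if out ! 0 = Some p \<and> legal out then 1 else 0)"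

text \<open>
  What \<open>a\<close> knows when it takes its step of round \<open>r\<close>, if everybody has followed \<open>\<Lambda>\<close>
  so far: its private information, from round 1 on the outcome of Wake-Up, from round 2 on its own
  coins, and the messages it has received.
\<close>

definition view ::
  "('x, 'c, 'm, 'y) algorithm \<Rightarrow> nat \<Rightarrow> ('x, 'c, 'y) world \<Rightarrow>
   (nat \<times> 'x \<times> 'y) \<times> nat list option \<times> 'c option \<times> 'm history" where
  "view \<Lambda> r w = ((ids w ! 0, inputs w ! 0, prefs w ! 0),
     (if r \<ge> 1 then Some (ids w) else None),
     (if r \<ge> 2 then Some (coins w ! 0) else None),
     received \<Lambda> w (follow \<Lambda> w) (r - 1) 0)"

text \<open>
  The distribution of the output vector, as estimated by \<open>a\<close> at round \<open>r\<close> of the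
  execution \<open>w\<close>, if \<open>a\<close> plays \<open>S\<close>, and the resulting expected utility.  \<open>S\<close> takes the world
  as an argument only because the steps before round \<open>r\<close> use the private information of \<open>a\<close>.
\<close>

definition estimate ::
  "('x, 'c, 'y) world pmf \<Rightarrow> ('x, 'c, 'm, 'y) algorithm \<Rightarrow> nat \<Rightarrow> ('x, 'c, 'y) world \<Rightarrow>
   (('x, 'c, 'y) world \<Rightarrow> ('m, 'y) strategy) \<Rightarrow> 'y option list pmf" where
  "estimate P \<Lambda> r w S =
     map_pmf (\<lambda>w'. outcome \<Lambda> w' (S w')) (cond_pmf P {w'. view \<Lambda> r w' = view \<Lambda> r w})"

definition expected_utility ::
  "('x, 'c, 'y) world pmf \<Rightarrow> ('x, 'c, 'm, 'y) algorithm \<Rightarrow> nat \<Rightarrow> ('x, 'c, 'y) world \<Rightarrow>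
   (('x, 'c, 'y) world \<Rightarrow> ('m, 'y) strategy) \<Rightarrow> real" where
  "expected_utility P \<Lambda> r w S =
     measure_pmf.expectation (estimate P \<Lambda> r w S) (utility (prefs w ! 0))"

text \<open>
  Collisions of fake ids with real ones are disregarded: fake ids come from outside of \<open>U\<close>.
\<close>

definition admissible :: "nat set \<Rightarrow> ('x, 'c, 'y) world \<Rightarrow> ('m, 'y) strategy \<Rightarrow> bool" where
  "admissible U w s \<longleftrightarrow> names s \<noteq> [] \<and> distinct (names s) \<and> set (names s) \<subseteq> insert (ids w ! 0) (- U)"

text \<open>
  A deviating step at round \<open>r\<close> may be followed by arbitrary further steps of the deviating agent.
  The strategy \<open>s\<close> is chosen after \<open>w\<close>, but it matters only through its effect on all worlds
  that \<open>a\<close> cannot distinguish from \<open>w\<close>.  So it may use everything \<open>a\<close> knows at round \<open>r\<close>.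
\<close>

definition distributed_equilibrium ::
  "nat set \<Rightarrow> 'y set \<Rightarrow> nat pmf \<Rightarrow> ('x, 'c, 'm, 'y) algorithm \<Rightarrow> bool" where
  "distributed_equilibrium U Y \<sigma> \<Lambda> \<longleftrightarrow>
     (\<forall>w \<in> set_pmf (prior U Y \<sigma>). \<forall>r \<le> last_round \<Lambda> (ring_size w). \<forall>s. admissible U w s \<longrightarrow>
        expected_utility (prior U Y \<sigma>) \<Lambda> r w (follow \<Lambda>) \<ge>
        expected_utility (prior U Y \<sigma>) \<Lambda> r w (\<lambda>w'. switch r (follow \<Lambda> w') s))"


section \<open>Knowledge Sharing\<close>

definition full_knowledge :: "('x list \<Rightarrow> 'y) \<Rightarrow> bool" where
  "full_knowledge q \<longleftrightarrow> (\<forall>xs j. j < length xs \<longrightarrow> (\<forall>y \<in> range q. \<forall>y' \<in> range q.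
     card {x. q (xs[j := x]) = y} = card {x. q (xs[j := x]) = y'}))"

definition knowledge_sharing_function :: "nat \<Rightarrow> ('x list \<Rightarrow> 'y) \<Rightarrow> bool" where
  "knowledge_sharing_function k q \<longleftrightarrow> card (range q) = k \<and> full_knowledge q"

text \<open>\<open>q\<close> need not be symmetric: its arguments are ordered by increasing id.\<close>

definition by_id :: "nat list \<Rightarrow> (nat \<Rightarrow> 'x) \<Rightarrow> 'x list" where
  "by_id R val = map val (sort R)"

definition correct_output :: "('x list \<Rightarrow> 'y) \<Rightarrow> ('x, 'c, 'y) world \<Rightarrow> 'y" where
  "correct_output q w = q (by_id (ids w) (\<lambda>i. the (map_of (zip (ids w) (inputs w)) i)))"

definition solves_knowledge_sharing ::
  "nat set \<Rightarrow> ('x list \<Rightarrow> 'y) \<Rightarrow> nat pmf \<Rightarrow> ('x, 'c, 'm, 'y) algorithm \<Rightarrow> bool" where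
  "solves_knowledge_sharing U q \<sigma> \<Lambda> \<longleftrightarrow>
     (\<forall>w \<in> set_pmf (prior U (range q) \<sigma>).
        outcome \<Lambda> w (follow \<Lambda> w) = replicate (ring_size w) (Some (correct_output q w)))"


section \<open>The protocol\<close>

text \<open>
  \<open>Share1\<close>, \<open>Share2\<close>: the Secret-Transmits to \<open>b\<^sup>1\<close> and \<open>b\<^sup>2\<close>; \<open>Reveal\<close>: the input sent
  around the ring (clockwise).  A message consists of values tagged by the id of their origin and
  their kind.  Of the two parts of a secret, the one travelling clockwise is the random number.
\<close>

datatype kind = Share1 | Share2 | Reveal

type_synonym 'x message = "nat \<times> kind \<rightharpoonup> 'x"

text \<open>
  The number of hops a value makes in a ring of size \<open>N\<close>.  For a secret, it is the distance from
  its origin to its target \<open>b\<close> in the given direction.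
\<close>

fun hops :: "nat \<Rightarrow> kind \<Rightarrow> direction \<Rightarrow> nat" where
  "hops N Share1 Cw = 1"
| "hops N Share1 Ccw = N - 1"
| "hops N Share2 Cw = N - N div 2"
| "hops N Share2 Ccw = N div 2"
| "hops N Reveal Cw = N - 1"
| "hops N Reveal Ccw = 0"

text \<open>
  The round at which the agent at distance \<open>k\<close> from the origin sends a value on.  Secrets start at
  round 1; the agent just before \<open>b\<close> waits until round \<open>N - 1\<close>.
\<close>

definition send_round :: "nat \<Rightarrow> kind \<Rightarrow> direction \<Rightarrow> nat \<Rightarrow> nat" where
  "send_round N \<kappa> D k =
     (if \<kappa> = Reveal then N + 1 + k else if k + 1 = hops N \<kappa> D then N - 1 else k + 1)"

text \<open>
  In the following, \<open>R\<close> is the ring seen from the agent in question.  \<open>behind R D k\<close> is the id of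
  the agent whose messages travelling in direction \<open>D\<close> reach this agent after \<open>k\<close> hops.
\<close>

fun behind :: "nat list \<Rightarrow> direction \<Rightarrow> nat \<Rightarrow> nat" where
  "behind R Cw k = R ! ((length R - k) mod length R)"
| "behind R Ccw k = R ! (k mod length R)"

definition schedule :: "nat list \<Rightarrow> direction \<Rightarrow> nat \<Rightarrow> (nat \<times> kind) set" where
  "schedule R D t = {(behind R D k, \<kappa>) | k \<kappa>.
     k < hops (length R) \<kappa> D \<and> send_round (length R) \<kappa> D k = t}"

fun upstream_ring :: "nat list \<Rightarrow> direction \<Rightarrow> nat list" where
  "upstream_ring R Cw = rotate (length R - 1) R"
| "upstream_ring R Ccw = rotate 1 R"

text \<open>
  The operation written \<open>\<oplus>\<close> in the description of Secret-Transmit is the addition of an arbitrary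
  finite abelian group; bitwise exclusive or is a special case.
\<close>

definition own_values :: "nat list \<Rightarrow> 'x \<Rightarrow> 'x \<times> 'x \<Rightarrow> direction \<Rightarrow> 'x::ab_group_add message" where
  "own_values R x c D = (let i = R ! 0 in case D of
     Cw \<Rightarrow> [(i, Share1) \<mapsto> fst c, (i, Share2) \<mapsto> snd c, (i, Reveal) \<mapsto> x]
   | Ccw \<Rightarrow> [(i, Share1) \<mapsto> fst c + x, (i, Share2) \<mapsto> snd c + x])"

definition known_values ::
  "nat list \<Rightarrow> 'x \<Rightarrow> 'x \<times> 'x \<Rightarrow> 'x message history \<Rightarrow> direction \<Rightarrow> 'x::ab_group_add message" where
  "known_values R x c h D = foldl (\<lambda>m inbox. m ++ inbox D) (own_values R x c D) h"

text \<open>Detection of missing, untimely or superfluous values.\<close>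

definition on_schedule :: "nat list \<Rightarrow> 'x message history \<Rightarrow> bool" where
  "on_schedule R h \<longleftrightarrow>
     (\<forall>t < length h. \<forall>D. dom ((h ! t) D) = schedule (upstream_ring R D) D (t + 1))"

text \<open>
  Detection of a lie: an agent compares the secrets it was the target of with the inputs that
  their origins send around the ring.
\<close>

definition secrets_match ::
  "nat list \<Rightarrow> 'x \<Rightarrow> 'x \<times> 'x \<Rightarrow> 'x::ab_group_add message history \<Rightarrow> bool" where
  "secrets_match R x c h \<longleftrightarrow> (\<forall>\<kappa> \<in> {Share1, Share2}.
     let i = behind R Cw (hops (length R) \<kappa> Cw) in
     the (known_values R x c h Ccw (i, \<kappa>)) - the (known_values R x c h Cw (i, \<kappa>)) =
     the (known_values R x c h Cw (i, Reveal)))"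

definition knowledge_sharing_in_a_ring ::
  "nat \<Rightarrow> ('x::ab_group_add list \<Rightarrow> 'y) \<Rightarrow> ('x, 'x \<times> 'x, 'x message, 'y) algorithm" where
  "knowledge_sharing_in_a_ring \<beta> q = \<lparr>
     alg_send = (\<lambda>R x c h D. known_values R x c h D |` schedule R D (length h + 1)),
     alg_output = (\<lambda>R x c h.
       if length R \<le> \<beta> \<and> on_schedule R h \<and> secrets_match R x c h
       then Some (q (by_id R (\<lambda>i. the (known_values R x c h Cw (i, Reveal))))) else None),
     last_round = (\<lambda>N. 2 * N)\<rparr>"

end

theory Submission
  imports Defs
begin

text \<open>
  Let the deviating agent present \<open>d\<close> agents in a ring of \<open>n\<close> real ones.  If \<open>d < n\<close>, then every
  fake agent is committed to its input by the values that its (honest) second target holds when the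
  messages of round \<open>N - 1\<close> have arrived, where \<open>N = n + d - 1\<close>.  Until then the deviator knows
  nothing about the input of its counter-clockwise neighbor: changing that input by \<open>\<delta>\<close> and the first
  random number of the neighbor by \<open>-\<delta>\<close> does not affect any message that the deviator receives in
  time.  By the Full Knowledge property, averaging over \<open>\<delta>\<close> bounds the probability of a favourable
  output by 1/2, which is what an honest agent expects.  A deviation from round \<open>n\<close> on comes after
  the commitment to the true input and can therefore only destroy the output.

  A duplication with \<open>d \<ge> n\<close> may succeed with certainty, but it is detected if \<open>n > \<beta> + 1 - d\<close>.  The
  reflection \<open>n \<mapsto> \<beta> + 2 - n\<close> maps the ring sizes of the former kind injectively to those of
  the latter kind.
\<close>

section \<open>Positions and schedules\<close>

lemma length_upstream_ring [simp]: "length (upstream_ring R D) = length R"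
  by (cases D) auto

lemma distinct_upstream_ring [simp]: "distinct (upstream_ring R D) = distinct R"
  by (cases D) auto

lemma behind_upstream_ring:
  assumes "k < length R"
  shows "behind (upstream_ring R D) D k = behind R D (Suc k)"
proof (cases D)
  case Cw
  have "(length R - 1 + (length R - k) mod length R) mod length R = (length R - Suc k) mod length R"
  proof (cases "k = 0")
    case False
    then have "(length R - 1 + (length R - k) mod length R) mod length R =
        (length R + (length R - Suc k)) mod length R"
      using assms by simp
    then show ?thesis by (metis mod_add_self1)
  qed (use assms in simp)
  moreover have "(length R - k) mod length R < length R"
    using assms by (intro mod_less_divisor) linarith
  ultimately show ?thesis
    unfolding Cw behind.simps upstream_ring.simps length_rotate by (simp only: nth_rotate)
next
  case Ccw
  moreover have "k mod length R = k" using assms by simp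
  ultimately show ?thesis using assms by (simp only: behind.simps upstream_ring.simps length_rotate nth_rotate) simp
qed

lemma behind_0: "R \<noteq> [] \<Longrightarrow> behind R D 0 = R ! 0"
  by (cases D) auto

lemma behind_eq_iff:
  assumes "distinct R" "k < length R" "k' < length R"
  shows "behind R D k = behind R D k' \<longleftrightarrow> k = k'"
proof (cases D)
  case Cw
  have *: "(length R - k) mod length R = (if k = 0 then 0 else length R - k)" if "k < length R" for k
    using that by auto
  show ?thesis
    using assms Cw by (auto simp: * nth_eq_iff_index_eq)
next
  case Ccw
  then show ?thesis
    using assms by (simp add: nth_eq_iff_index_eq)
qed

lemma ex_behind:
  assumes "i \<in> set R"
  obtains k where "k < length R" "i = behind R D k"
proof -
  obtain m where m: "m < length R" "i = R ! m"
    using assms by (metis in_set_conv_nth)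
  show thesis
  proof (cases D)
    case Cw
    show thesis
    proof (rule that[of "(length R - m) mod length R"])
      show "(length R - m) mod length R < length R" using m by (intro mod_less_divisor) linarith
      show "i = behind R D ((length R - m) mod length R)"
        using m Cw by (cases "m = 0") auto
    qed
  next
    case Ccw
    then show thesis using m that[of m] by simp
  qed
qed

lemma hops_le: "2 \<le> N \<Longrightarrow> hops N \<kappa> D \<le> N - 1"
  by (cases \<kappa>; cases D) simp_all

text \<open>Distances below the ring size name distinct agents, so a scheduled key determines its
  distance and the schedule becomes pure arithmetic.\<close>

lemma schedule_iff:
  assumes "distinct R" "2 \<le> length R" "k < length R"
  shows "(behind R D k, \<kappa>) \<in> schedule R D t \<longleftrightarrow>
    k < hops (length R) \<kappa> D \<and> send_round (length R) \<kappa> D k = t"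
proof
  assume "(behind R D k, \<kappa>) \<in> schedule R D t"
  then obtain k' where k': "behind R D k = behind R D k'" "k' < hops (length R) \<kappa> D"
      "send_round (length R) \<kappa> D k' = t"
    by (auto simp: schedule_def)
  moreover have "k' < length R"
    using k'(2) hops_le[OF assms(2), of \<kappa> D] by linarith
  ultimately show "k < hops (length R) \<kappa> D \<and> send_round (length R) \<kappa> D k = t"
    using behind_eq_iff[OF assms(1,3), of k' D] by simp
qed (auto simp: schedule_def)

text \<open>An agent must receive what its upstream neighbor must send. That neighbor is one hop
  nearer to the origin, whence \<open>k - 1\<close>; the target, at distance \<open>hops\<close>, is
  included.\<close>

lemma schedule_upstream_iff:
  assumes "distinct R" "2 \<le> length R" "0 < k" "k < length R"
  shows "(behind R D k, \<kappa>) \<in> schedule (upstream_ring R D) D t \<longleftrightarrow>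
    k \<le> hops (length R) \<kappa> D \<and> send_round (length R) \<kappa> D (k - 1) = t"
proof -
  obtain m where m: "k = Suc m" using assms(3) by (cases k) auto
  then have "behind (upstream_ring R D) D m = behind R D k"
    using behind_upstream_ring[of m R D] assms(4) by simp
  then show ?thesis
    using schedule_iff[of "upstream_ring R D" m D \<kappa> t] assms m by (simp add: Suc_le_eq)
qed

text \<open>A value makes at most \<open>N - 1\<close> hops and never returns to its origin, so
  traffic on schedule cannot overwrite an agent's own values.\<close>

lemma own_not_scheduled_upstream:
  assumes "distinct R" "2 \<le> length R"
  shows "(R ! 0, \<kappa>) \<notin> schedule (upstream_ring R D) D t"
proof
  assume "(R ! 0, \<kappa>) \<in> schedule (upstream_ring R D) D t"
  then obtain k where k: "R ! 0 = behind (upstream_ring R D) D k" "k < hops (length R) \<kappa> D"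
    by (auto simp: schedule_def)
  with hops_le[OF assms(2), of \<kappa> D] have "k + 1 < length R" by linarith
  with k(1) have "behind R D 0 = behind R D (k + 1)"
    using behind_upstream_ring[of k R D] behind_0[of R D] by (cases "R = []") auto
  then show False
    using behind_eq_iff[OF assms(1), of 0 "k + 1" D] \<open>k + 1 < length R\<close> by (cases R) auto
qed

lemma send_round_share:
  assumes "k < hops N \<kappa> D" "\<kappa> \<noteq> Reveal" "2 \<le> N"
  shows "send_round N \<kappa> D k \<le> N - 1"
  using assms hops_le[OF assms(3), of \<kappa> D] by (auto simp: send_round_def)

section \<open>Known values\<close>

lemma known_values_Nil [simp]: "known_values R x c [] D = own_values R x c D"
  by (simp add: known_values_def)

lemma known_values_snoc [simp]:
  "known_values R x c (h @ [b]) D = known_values R x c h D ++ b D"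
  by (simp add: known_values_def)

lemma known_values_append_eq:
  assumes "\<And>b. b \<in> set h' \<Longrightarrow> key \<notin> dom (b D)"
  shows "known_values R x c (h @ h') D key = known_values R x c h D key"
  using assms
proof (induction h' rule: rev_induct)
  case (snoc b h')
  then show ?case
    by (simp flip: append_assoc add: map_add_dom_app_simps)
qed simp

text \<open>In \<open>known_values\<close> later messages override earlier ones. Since
  \<open>on_schedule\<close> confines each key to its scheduled rounds, a key that is no longer due
  is frozen.\<close>

lemma known_values_take:
  assumes "on_schedule R h"
    and "\<And>t. T \<le> t \<Longrightarrow> t < length h \<Longrightarrow> key \<notin> schedule (upstream_ring R D) D (t + 1)"
  shows "known_values R x c h D key = known_values R x c (take T h) D key"
proof -
  have "key \<notin> dom (b D)" if b: "b \<in> set (drop T h)" for b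
  proof -
    obtain i where i: "i < length (drop T h)" "drop T h ! i = b"
      using b unfolding in_set_conv_nth by blast
    then have "T + i < length h" "b = h ! (T + i)"
      by auto
    then show ?thesis
      using assms(1) assms(2)[of "T + i"] unfolding on_schedule_def by simp
  qed
  then have "known_values R x c (take T h @ drop T h) D key = known_values R x c (take T h) D key"
    by (rule known_values_append_eq)
  then show ?thesis by simp
qed

text \<open>Stated for a single key, because the two executions compared under a shift agree only
  outside the hidden keys.\<close>

lemma known_values_cong:
  assumes "length h = length h'" "own_values R x c D key = own_values R x' c' D key"
    and "\<And>t. t < length h \<Longrightarrow> (h ! t) D key = (h' ! t) D key"
  shows "known_values R x c h D key = known_values R x' c' h' D key"
proof -
  have *: "m key = m' key \<Longrightarrow>
      foldl (\<lambda>m b. m ++ b D) m h key = foldl (\<lambda>m b. m ++ b D) m' h' key"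
    if "list_all2 (\<lambda>b b'. b D key = b' D key) h h'" for m m' :: "'a message"
    using that
  proof (induction h h' arbitrary: m m' rule: list_all2_induct)
    case (Cons b h b' h')
    then have "(m ++ b D) key = (m' ++ b' D) key"
      unfolding map_add_def by (simp only:)
    then show ?case by (simp only: foldl_Cons Cons.IH[of "m ++ b D" "m' ++ b' D"])
  qed (simp only: foldl_Nil)
  show ?thesis
    unfolding known_values_def
    using assms by (intro *[of "own_values R x c D" "own_values R x' c' D"]) (simp_all add: list_all2_conv_all_nth)
qed

lemma own_values_eq_None:
  assumes "i \<noteq> R ! 0"
  shows "own_values R x c D (i, \<kappa>) = None"
  using assms by (simp add: own_values_def Let_def split: direction.split)

lemma length_received [simp]: "length (received \<Lambda> w s t k) = t"
  by (induction t arbitrary: k) auto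
lemma received_nth:
  assumes "t < T"
  shows "received \<Lambda> w s T k ! t = (\<lambda>D. node_send \<Lambda> w s (upstream (ring_size w) D k)
    (received \<Lambda> w s t (upstream (ring_size w) D k)) D)"
  using assms by (induction T) (auto simp: nth_append less_Suc_eq Let_def)
lemma take_received: assumes "t \<le> T" shows "take t (received \<Lambda> w s T k) = received \<Lambda> w s t k"
proof (rule nth_equalityI, goal_cases)
  case (2 i)
  then have "i < t" "i < T" using assms by simp_all
  then show ?case by (simp only: nth_take received_nth)
qed (use assms in simp)
lemma upstream_less: "0 < n \<Longrightarrow> upstream n D k < n"
proof (cases D)
qed simp_all

section \<open>Honest executions\<close>

lemma known_values_map_le:
  assumes "own_values R x c D \<subseteq>\<^sub>m f" "\<And>b. b \<in> set h \<Longrightarrow> b D \<subseteq>\<^sub>m f"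
  shows "known_values R x c h D \<subseteq>\<^sub>m f"
  using assms(2)
proof (induction h rule: rev_induct)
  case (snoc b h)
  then show ?case by (simp add: map_add_le_mapI)
qed (simp add: assms(1))

lemma dom_known_values:
  "dom (known_values R x c h D) = dom (own_values R x c D) \<union> (\<Union>b \<in> set h. dom (b D))"
  by (induction h rule: rev_induct) auto

lemma own_values_dom:
  assumes "0 < hops N \<kappa> D"
  shows "(R ! 0, \<kappa>) \<in> dom (own_values R x c D)"
  using assms by (cases \<kappa>; cases D) (simp_all add: own_values_def Let_def)

lemma own_values_cong: "R ! 0 = R' ! 0 \<Longrightarrow> own_values R x c D = own_values R' x c D"
  by (simp add: own_values_def Let_def)

lemma send_round_pred:
  assumes "0 < k" "k < hops N \<kappa> D" "2 \<le> N"
  shows "send_round N \<kappa> D (k - 1) < send_round N \<kappa> D k"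
  using assms hops_le[OF assms(3), of \<kappa> D] by (simp add: send_round_def)

lemma send_round_pos: "2 \<le> N \<Longrightarrow> 0 < send_round N \<kappa> D k"
  by (simp add: send_round_def)

section \<open>The values carried in an honest execution\<close>

definition value_at :: "nat list \<Rightarrow> 'a list \<Rightarrow> nat \<Rightarrow> 'a" where
  "value_at R vs i = the (map_of (zip R vs) i)"

lemma value_at_nth:
  assumes "distinct R" "length R = length vs" "k < length R"
  shows "value_at R vs (R ! k) = vs ! k"
  using assms by (simp add: value_at_def map_of_zip_nth)

text \<open>The content of each key in an honest execution, whoever holds it. The ring
  \<open>[i]\<close> can stand for the view of the origin since \<open>own_values\<close> reads only
  the head of the ring.\<close>

definition true_values ::
    "('x::ab_group_add, 'x \<times> 'x, 'y) world \<Rightarrow> direction \<Rightarrow> 'x message" where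
  "true_values w D = (\<lambda>(i, \<kappa>).
     own_values [i] (value_at (ids w) (inputs w) i) (value_at (ids w) (coins w) i) D (i, \<kappa>))"

definition proper_world :: "('x, 'c, 'y) world \<Rightarrow> bool" where
  "proper_world w \<longleftrightarrow> 2 \<le> ring_size w \<and> distinct (ids w) \<and>
     length (inputs w) = ring_size w \<and> length (coins w) = ring_size w"

lemma own_values_eq_true_values:
  assumes "proper_world w" "k < ring_size w"
  shows "own_values (rotate k (ids w)) (inputs w ! k) (coins w ! k) D (ids w ! k, \<kappa>) =
    true_values w D (ids w ! k, \<kappa>)"
proof -
  have "rotate k (ids w) ! 0 = [ids w ! k] ! 0"
    using assms by (subst nth_rotate) auto
  note cong = own_values_cong[OF this]
  have "value_at (ids w) (inputs w) (ids w ! k) = inputs w ! k"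
      "value_at (ids w) (coins w) (ids w ! k) = coins w ! k"
    using assms by (auto simp: proper_world_def intro!: value_at_nth)
  then show ?thesis
    by (simp add: true_values_def cong)
qed

lemma own_values_map_le_true_values:
  assumes "proper_world w" "k < ring_size w"
  shows "own_values (rotate k (ids w)) (inputs w ! k) (coins w ! k) D \<subseteq>\<^sub>m true_values w D"
  unfolding map_le_def
proof
  fix key
  assume key: "key \<in> dom (own_values (rotate k (ids w)) (inputs w ! k) (coins w ! k) D)"
  have "rotate k (ids w) ! 0 = ids w ! k"
    using assms by (subst nth_rotate) auto
  with key have "fst key = ids w ! k"
    using own_values_eq_None[of "fst key" "rotate k (ids w)" "inputs w ! k" "coins w ! k" D "snd key"]
    by (cases "fst key = ids w ! k") auto
  then show "own_values (rotate k (ids w)) (inputs w ! k) (coins w ! k) D key = true_values w D key"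
    using own_values_eq_true_values[OF assms, of D "snd key"] by (metis prod.collapse)
qed

lemma enlarged_ring_follow:
  assumes "ids w \<noteq> []"
  shows "enlarged_ring w (follow \<Lambda> w) = ids w"
  using assms by (cases "ids w") (simp_all add: enlarged_ring_def follow_def)

lemma node_send_follow:
  assumes "ids w \<noteq> []"
  shows "node_send \<Lambda> w (follow \<Lambda> w) k = alg_send \<Lambda> (rotate k (ids w)) (inputs w ! k) (coins w ! k)"
  using enlarged_ring_follow[OF assms, of \<Lambda>]
  by (cases "k = 0") (simp_all add: node_send_def seen_from_def follow_def)

lemma node_output_follow:
  assumes "ids w \<noteq> []"
  shows "node_output \<Lambda> w (follow \<Lambda> w) k = alg_output \<Lambda> (rotate k (ids w)) (inputs w ! k) (coins w ! k)"
  using enlarged_ring_follow[OF assms, of \<Lambda>]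
  by (cases "k = 0") (simp_all add: node_output_def seen_from_def follow_def)

lemma upstream_ring_rotate:
  assumes "R \<noteq> []"
  shows "upstream_ring (rotate k R) D = rotate (upstream (length R) D k) R"
proof (cases D)
  case Cw
  have "rotate (length R - 1 + k) R = rotate ((length R - 1 + k) mod length R) R"
    by (rule rotate_conv_mod)
  moreover have "length R - 1 + k = k + length R - 1"
    using assms by (cases R) auto
  ultimately show ?thesis using Cw by (simp add: rotate_rotate)
next
  case Ccw
  have "rotate (k + 1) R = rotate ((k + 1) mod length R) R"
    by (rule rotate_conv_mod)
  then show ?thesis using Ccw by simp
qed

lemma true_values_dom:
  assumes "0 < hops N \<kappa> D"
  shows "(i, \<kappa>) \<in> dom (true_values w D)"
  using own_values_dom[OF assms, of "[i]"] by (simp add: true_values_def dom_def)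

lemma schedule_subset_dom_true_values: "schedule R D t \<subseteq> dom (true_values w D)"
proof
  fix key assume "key \<in> schedule R D t"
  then obtain k \<kappa> where "key = (behind R D k, \<kappa>)" "k < hops (length R) \<kappa> D"
    by (auto simp: schedule_def)
  then show "key \<in> dom (true_values w D)"
    using true_values_dom[of "length R" \<kappa> D] by simp
qed

text \<open>The two distances add up to a full turn, so both parts of a secret reach the same
  target.\<close>

lemma hops_Cw_Ccw:
  assumes "\<kappa> \<noteq> Reveal" "0 < N"
  shows "hops N \<kappa> Cw + hops N \<kappa> Ccw = N"
  using assms by (cases \<kappa>) auto

lemma hops_pos:
  assumes "2 \<le> N" "\<kappa> \<noteq> Reveal"
  shows "0 < hops N \<kappa> D"
proof -
  have "0 < N div 2" "N div 2 < N" using assms by auto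
  then show ?thesis using assms by (cases \<kappa>; cases D) simp_all
qed

text \<open>Sorting removes the rotation: agents that see the ring from different positions apply
  \<open>q\<close> to the same list.\<close>

lemma by_id_cong:
  assumes "set R = set R'" "distinct R" "distinct R'" "\<And>i. i \<in> set R \<Longrightarrow> f i = f' i"
  shows "by_id R f = by_id R' f'"
proof -
  have "sort R = sort R'"
    using assms by (metis sorted_list_of_set_sort_remdups distinct_remdups_id)
  then show ?thesis
    using assms(4) unfolding by_id_def by (metis map_cong set_sort)
qed

context
  fixes \<beta> :: nat and q :: "'x::ab_group_add list \<Rightarrow> 'y" and w :: "('x, 'x \<times> 'x, 'y) world"
  assumes proper: "proper_world w"
begin

private abbreviation (input) "honest_history t k \<equiv>
  received (knowledge_sharing_in_a_ring \<beta> q) w (follow (knowledge_sharing_in_a_ring \<beta> q) w) t k"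

private abbreviation (input) "honest_known t k \<equiv>
  known_values (rotate k (ids w)) (inputs w ! k) (coins w ! k) (honest_history t k)"

lemma honest_history_nth:
  assumes "t < T"
  shows "(honest_history T k ! t) D =
    honest_known t (upstream (ring_size w) D k) D |` schedule (upstream_ring (rotate k (ids w)) D) D (t + 1)"
proof -
  have ne: "ids w \<noteq> []" using proper by (auto simp: proper_world_def)
  have "honest_history T k ! t = (\<lambda>D. node_send (knowledge_sharing_in_a_ring \<beta> q) w
      (follow (knowledge_sharing_in_a_ring \<beta> q) w) (upstream (ring_size w) D k)
      (honest_history t (upstream (ring_size w) D k)) D)"
    by (rule received_nth[OF assms])
  then show ?thesis
    unfolding node_send_follow[OF ne] upstream_ring_rotate[OF ne]
    by (simp add: knowledge_sharing_in_a_ring_def)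
qed

text \<open>Two facts are combined: what an agent knows never contradicts
  \<open>true_values\<close>, and what is due now is its own or arrived earlier, because the send
  rounds of a key increase along its path. The induction covers all nodes at once, as inboxes come
  from neighbors.\<close>

lemma honest_send:
  assumes "k < ring_size w"
  shows "honest_known t k D |` schedule (rotate k (ids w)) D (t + 1) =
    true_values w D |` schedule (rotate k (ids w)) D (t + 1)"
  using assms
proof (induction t arbitrary: k D rule: less_induct)
  case (less t)
  let ?R = "rotate k (ids w)" and ?n = "ring_size w"
  have n: "2 \<le> ?n" "distinct (ids w)" "ids w \<noteq> []"
    using proper by (auto simp: proper_world_def)
  have R0: "?R ! 0 = ids w ! k"
    using less.prems n by (subst nth_rotate) auto
  have inbox: "(honest_history t k ! t') D = true_values w D |` schedule (upstream_ring ?R D) D (t' + 1)"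
    if "t' < t" for t'
    using less.IH[OF that, of "upstream ?n D k" D] upstream_less[of ?n D k] n
    unfolding honest_history_nth[OF that] by (simp add: upstream_ring_rotate)
  have le: "honest_known t k D \<subseteq>\<^sub>m true_values w D"
  proof (rule known_values_map_le)
    show "own_values ?R (inputs w ! k) (coins w ! k) D \<subseteq>\<^sub>m true_values w D"
      by (rule own_values_map_le_true_values[OF proper less.prems])
    fix b assume "b \<in> set (honest_history t k)"
    then obtain t' where "t' < t" "b = honest_history t k ! t'"
      unfolding in_set_conv_nth by auto
    then show "b D \<subseteq>\<^sub>m true_values w D"
      using inbox by (simp add: map_le_def)
  qed
  show ?case
  proof (rule ext)
    fix key
    show "(honest_known t k D |` schedule ?R D (t + 1)) key = (true_values w D |` schedule ?R D (t + 1)) key"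
    proof (cases "key \<in> schedule ?R D (t + 1)")
      case True
      then obtain m \<kappa> where m: "key = (behind ?R D m, \<kappa>)" "m < hops ?n \<kappa> D" "send_round ?n \<kappa> D m = t + 1"
        by (auto simp: schedule_def)
      have "key \<in> dom (honest_known t k D)"
      proof (cases "m = 0")
        case True
        then have "key = (?R ! 0, \<kappa>)"
          using m(1) n by (simp add: behind_0)
        with own_values_dom[of ?n \<kappa> D ?R "inputs w ! k" "coins w ! k"] m(2)
        show ?thesis unfolding dom_known_values by simp
      next
        case False
        \<comment> \<open>The inbox that holds the key: entry \<open>?t'\<close> of a history
          contains what was sent at round \<open>?t' + 1\<close>.\<close>
        let ?t' = "send_round ?n \<kappa> D (m - 1) - 1"
        have r: "send_round ?n \<kappa> D (m - 1) = ?t' + 1" "?t' < t"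
          using send_round_pred[of m ?n \<kappa> D] send_round_pos[of ?n \<kappa> D "m - 1"] m False n by auto
        have "m < ?n" using m(2) hops_le[OF n(1), of \<kappa> D] by linarith
        then have s: "key \<in> schedule (upstream_ring ?R D) D (?t' + 1)"
          using schedule_upstream_iff[of ?R m D \<kappa> "?t' + 1"] m n False r(1) by simp
        have "key \<in> dom (true_values w D)"
          using true_values_dom[of ?n \<kappa> D] m by simp
        with s have "key \<in> dom ((honest_history t k ! ?t') D)"
          unfolding inbox[OF r(2)] by simp
        moreover have "honest_history t k ! ?t' \<in> set (honest_history t k)"
          using r(2) by (intro nth_mem) simp
        ultimately show ?thesis
          unfolding dom_known_values by blast
      qed
      with le have "honest_known t k D key = true_values w D key"
        by (simp add: map_le_def)
      then show ?thesis by (simp add: restrict_map_def)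
    qed simp
  qed
qed

lemma honest_inbox:
  assumes "k < ring_size w" "t < T"
  shows "(honest_history T k ! t) D = true_values w D |` schedule (upstream_ring (rotate k (ids w)) D) D (t + 1)"
proof -
  have "ids w \<noteq> []" "0 < ring_size w" using assms by auto
  then show ?thesis
    unfolding honest_history_nth[OF assms(2)] upstream_ring_rotate[OF \<open>ids w \<noteq> []\<close>]
    by (intro honest_send upstream_less)
qed

lemma honest_on_schedule:
  assumes "k < ring_size w"
  shows "on_schedule (rotate k (ids w)) (honest_history T k)"
  unfolding on_schedule_def
proof (intro allI impI)
  fix t D
  assume "t < length (honest_history T k)"
  then have "t < T" by simp
  show "dom ((honest_history T k ! t) D) = schedule (upstream_ring (rotate k (ids w)) D) D (t + 1)"
    unfolding honest_inbox[OF assms \<open>t < T\<close>] dom_restrict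
    using schedule_subset_dom_true_values by blast
qed

text \<open>The bound \<open>m \<le> hops\<close> includes the target, which learns a value that it
  does not send on.\<close>

lemma honest_known_eq:
  assumes "k < ring_size w" "m < ring_size w" "m \<le> hops (ring_size w) \<kappa> D" "0 < hops (ring_size w) \<kappa> D"
    and "0 < m \<Longrightarrow> send_round (ring_size w) \<kappa> D (m - 1) \<le> T"
  shows "honest_known T k D (behind (rotate k (ids w)) D m, \<kappa>) =
    true_values w D (behind (rotate k (ids w)) D m, \<kappa>)"
proof -
  let ?R = "rotate k (ids w)" and ?n = "ring_size w"
  let ?key = "(behind ?R D m, \<kappa>)"
  have n: "2 \<le> ?n" "distinct (ids w)" "ids w \<noteq> []"
    using proper by (auto simp: proper_world_def)
  have "honest_known T k D \<subseteq>\<^sub>m true_values w D"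
  proof (rule known_values_map_le)
    show "own_values ?R (inputs w ! k) (coins w ! k) D \<subseteq>\<^sub>m true_values w D"
      by (rule own_values_map_le_true_values[OF proper assms(1)])
    fix b assume "b \<in> set (honest_history T k)"
    then obtain t where "t < T" "b = honest_history T k ! t"
      unfolding in_set_conv_nth by auto
    then show "b D \<subseteq>\<^sub>m true_values w D"
      using honest_inbox[OF assms(1)] by (simp add: map_le_def)
  qed
  moreover have "?key \<in> dom (honest_known T k D)"
  proof (cases "m = 0")
    case True
    then have "?key = (?R ! 0, \<kappa>)"
      using n by (simp add: behind_0)
    with own_values_dom[of ?n \<kappa> D ?R "inputs w ! k" "coins w ! k"] assms(4)
    show ?thesis unfolding dom_known_values by simp
  next
    case False
    let ?t = "send_round ?n \<kappa> D (m - 1) - 1"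
    have r: "send_round ?n \<kappa> D (m - 1) = ?t + 1" "?t < T"
      using assms(5) send_round_pos[of ?n \<kappa> D "m - 1"] False n by auto
    have "?key \<in> schedule (upstream_ring ?R D) D (?t + 1)"
      using schedule_upstream_iff[of ?R m D \<kappa> "?t + 1"] n False r(1) assms by simp
    then have "?key \<in> dom ((honest_history T k ! ?t) D)"
      unfolding honest_inbox[OF assms(1) r(2)] dom_restrict using schedule_subset_dom_true_values by blast
    moreover have "honest_history T k ! ?t \<in> set (honest_history T k)"
      using r(2) by (intro nth_mem) simp
    ultimately show ?thesis
      unfolding dom_known_values by blast
  qed
  ultimately show ?thesis by (simp add: map_le_def)
qed

lemma true_values_simps:
  "true_values w Cw (i, Share1) = Some (fst (value_at (ids w) (coins w) i))"
  "true_values w Cw (i, Share2) = Some (snd (value_at (ids w) (coins w) i))"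
  "true_values w Cw (i, Reveal) = Some (value_at (ids w) (inputs w) i)"
  "true_values w Ccw (i, Share1) = Some (fst (value_at (ids w) (coins w) i) + value_at (ids w) (inputs w) i)"
  "true_values w Ccw (i, Share2) = Some (snd (value_at (ids w) (coins w) i) + value_at (ids w) (inputs w) i)"
  by (simp_all add: true_values_def own_values_def Let_def)

section \<open>Correctness of the protocol\<close>

lemma honest_reveal:
  assumes "k < ring_size w" "i \<in> set (ids w)"
  shows "honest_known (2 * ring_size w - 1) k Cw (i, Reveal) = Some (value_at (ids w) (inputs w) i)"
proof -
  have n: "2 \<le> ring_size w" using proper by (simp add: proper_world_def)
  have "i \<in> set (rotate k (ids w))" using assms by simp
  then obtain m where m: "m < length (rotate k (ids w))" "i = behind (rotate k (ids w)) Cw m"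
    by (rule ex_behind)
  have "honest_known (2 * ring_size w - 1) k Cw (i, Reveal) = true_values w Cw (i, Reveal)"
    unfolding m(2) by (rule honest_known_eq) (use assms m(1) n in \<open>auto simp: send_round_def\<close>)
  then show ?thesis by (simp add: true_values_simps)
qed

lemma honest_secrets_match:
  assumes "k < ring_size w"
  shows "secrets_match (rotate k (ids w)) (inputs w ! k) (coins w ! k)
    (honest_history (2 * ring_size w - 1) k)"
proof -
  let ?R = "rotate k (ids w)" and ?n = "ring_size w"
  let ?T = "2 * ?n - 1"
  have n: "2 \<le> ?n" "distinct (ids w)" "ids w \<noteq> []"
    using proper by (auto simp: proper_world_def)
  have *: "the (honest_known ?T k Ccw (i, \<kappa>)) - the (honest_known ?T k Cw (i, \<kappa>)) =
      the (honest_known ?T k Cw (i, Reveal))"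
    if \<kappa>: "\<kappa> \<noteq> Reveal" and i: "i = behind ?R Cw (hops ?n \<kappa> Cw)" for \<kappa> i
  proof -
    have less: "hops ?n \<kappa> D < ?n" "0 < hops ?n \<kappa> D" for D
      using hops_le[OF n(1), of \<kappa> D] hops_pos[OF n(1) \<kappa>] n by auto
    \<comment> \<open>\<open>secrets_match\<close> locates the origin along the clockwise path; for
      the counter-clockwise part the same agent is located the other way round.\<close>
    have i': "i = behind ?R Ccw (hops ?n \<kappa> Ccw)"
    proof -
      have "?n - hops ?n \<kappa> Cw = hops ?n \<kappa> Ccw"
        using hops_Cw_Ccw[OF \<kappa>, of ?n] n by simp
      then show ?thesis using i by simp
    qed
    have round: "send_round ?n \<kappa> D (hops ?n \<kappa> D - 1) \<le> ?T" for D
      using send_round_share[of "hops ?n \<kappa> D - 1" ?n \<kappa> D] less \<kappa> n by simp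
    have "honest_known ?T k Cw (i, \<kappa>) = true_values w Cw (i, \<kappa>)"
      unfolding i by (rule honest_known_eq) (use less round assms in auto)
    moreover have "honest_known ?T k Ccw (i, \<kappa>) = true_values w Ccw (i, \<kappa>)"
      unfolding i' by (rule honest_known_eq) (use less round assms in auto)
    moreover have "i \<in> set (ids w)"
    proof -
      have "i \<in> set ?R"
        unfolding i by (auto simp del: set_rotate intro!: nth_mem mod_less_divisor) (use n in auto)
      then show ?thesis by simp
    qed
    moreover note honest_reveal[OF assms this]
    ultimately show ?thesis
      using \<kappa> by (cases \<kappa>) (simp_all add: true_values_simps)
  qed
  then show ?thesis
    unfolding secrets_match_def Let_def length_rotate by blast
qed

text \<open>The output at round \<open>2 * n\<close> rests on the messages of rounds up to
  \<open>2 * n - 1\<close>. By then every input has gone round the ring, and an honest history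
  passes all checks.\<close>

lemma outcome_follow:
  assumes "ring_size w \<le> \<beta>"
  shows "outcome (knowledge_sharing_in_a_ring \<beta> q) w (follow (knowledge_sharing_in_a_ring \<beta> q) w) =
    replicate (ring_size w) (Some (correct_output q w))"
proof -
  have ne: "ids w \<noteq> []" using proper by (auto simp: proper_world_def)
  let ?T = "2 * ring_size w - 1"
  have "alg_output (knowledge_sharing_in_a_ring \<beta> q) (rotate k (ids w)) (inputs w ! k) (coins w ! k)
      (honest_history ?T k) = Some (correct_output q w)" if k: "k < ring_size w" for k
  proof -
    have "by_id (rotate k (ids w)) (\<lambda>i. the (honest_known ?T k Cw (i, Reveal))) =
        by_id (ids w) (\<lambda>i. the (map_of (zip (ids w) (inputs w)) i))"
      by (rule by_id_cong)
        (use proper honest_reveal[OF k] in \<open>simp_all add: proper_world_def value_at_def\<close>)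
    then show ?thesis
      using honest_on_schedule[OF k] honest_secrets_match[OF k] assms
      by (simp add: knowledge_sharing_in_a_ring_def correct_output_def)
  qed
  moreover have "last_round (knowledge_sharing_in_a_ring \<beta> q) N = 2 * N" for N
    by (simp add: knowledge_sharing_in_a_ring_def)
  ultimately show ?thesis
    unfolding outcome_def node_output_follow[OF ne] enlarged_ring_follow[OF ne]
    by (intro nth_equalityI) simp_all
qed

end

section \<open>Deviations\<close>

text \<open>
  The number of the real node that is the second target of the \<open>j\<close>-th fake agent, provided that
  there are fewer fake agents than real ones; otherwise this target may be fake itself.
\<close>

definition checker :: "nat \<Rightarrow> nat \<Rightarrow> nat \<Rightarrow> nat" where
  "checker N d j = N - N div 2 + j + 1 - d"

definition node_known where
  "node_known \<beta> q w s t k = known_values (seen_from w s k) (inputs w ! k) (coins w ! k)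
     (received (knowledge_sharing_in_a_ring \<beta> q) w s t k)"

text \<open>Counter-clockwise part minus clockwise part is the input that the checker reconstructs
  for fake agent \<open>j\<close>. A history of length \<open>N - 1\<close> holds exactly the
  messages of rounds 1 to \<open>N - 1\<close>, after which no share is due. A missing value gives
  an unspecified but fixed result.\<close>

definition commitment where
  "commitment \<beta> q w s j = (let E = enlarged_ring w s; N = length E; k = checker N (length (names s)) j in
     the (node_known \<beta> q w s (N - 1) k Ccw (E ! j, Share2)) -
     the (node_known \<beta> q w s (N - 1) k Cw (E ! j, Share2)))"

definition committed_inputs where
  "committed_inputs \<beta> q w s = map (commitment \<beta> q w s) [0..<length (names s)] @ tl (inputs w)"

definition ring_with_fakes :: "('x, 'c, 'y) world \<Rightarrow> ('m, 'y) strategy \<Rightarrow> bool" where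
  "ring_with_fakes w s \<longleftrightarrow> proper_world w \<and> names s \<noteq> [] \<and> distinct (enlarged_ring w s)"

lemma behind_rotate_Cw:
  assumes "h \<le> length E" "p < length E" "0 < h"
  shows "behind (rotate p E) Cw h = E ! ((p + (length E - h)) mod length E)"
  using assms by (simp add: nth_rotate)

context
  fixes \<beta> :: nat and q :: "'x::ab_group_add list \<Rightarrow> 'y" and w :: "('x, 'x \<times> 'x, 'y) world"
    and s :: "('x message, 'y) strategy"
  assumes fakes: "ring_with_fakes w s"
begin

private abbreviation (input) "\<Lambda> \<equiv> knowledge_sharing_in_a_ring \<beta> q"
private abbreviation (input) "n \<equiv> ring_size w"
private abbreviation (input) "d \<equiv> length (names s)"
private abbreviation (input) "E \<equiv> enlarged_ring w s"
private abbreviation (input) "N \<equiv> length E"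
private abbreviation (input) "T \<equiv> 2 * N - 1"
private abbreviation (input) "known \<equiv> node_known \<beta> q w s"

lemma n_ge_2: "2 \<le> n" and d_pos: "0 < d" and distinct_E: "distinct E"
  and length_E: "N = d + n - 1"
  using fakes by (auto simp: ring_with_fakes_def proper_world_def enlarged_ring_def Suc_le_eq)

lemma N_ge_2: "2 \<le> N"
  using n_ge_2 d_pos unfolding length_E by linarith

lemma E_nth_honest: "0 < k \<Longrightarrow> k < n \<Longrightarrow> E ! (d + k - 1) = ids w ! k"
  by (cases k) (simp_all add: enlarged_ring_def nth_append nth_tl)

lemma length_seen_from [simp]: "length (seen_from w s k) = N"
  by (simp add: seen_from_def)

lemma distinct_seen_from [simp]: "distinct (seen_from w s k)"
  using distinct_E by (simp add: seen_from_def)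

lemma set_seen_from [simp]: "set (seen_from w s k) = set E"
  by (simp add: seen_from_def)

lemma seen_from_0: "0 < k \<Longrightarrow> k < n \<Longrightarrow> seen_from w s k ! 0 = ids w ! k"
  using length_E d_pos N_ge_2 E_nth_honest[of k] unfolding seen_from_def by (subst nth_rotate) auto

lemma upstream_seen_from: "0 < k \<Longrightarrow> upstream_ring (seen_from w s (Suc k)) Cw = seen_from w s k"
proof -
  assume "0 < k"
  have "rotate (N - 1 + (d + k)) E = rotate ((N - 1 + (d + k)) mod N) E"
    by (rule rotate_conv_mod)
  also have "(N - 1 + (d + k)) mod N = (d + k - 1 + N) mod N"
    using \<open>0 < k\<close> N_ge_2 by (intro arg_cong[where f="\<lambda>x. x mod N"]) linarith
  also have "rotate ((d + k - 1 + N) mod N) E = rotate (d + k - 1) E"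
    by (simp flip: rotate_conv_mod)
  finally show ?thesis
    by (simp add: seen_from_def rotate_rotate)
qed

lemma upstream_Cw_Suc: "0 < k \<Longrightarrow> k < n \<Longrightarrow> upstream n Cw (Suc k) = k"
  by simp

lemma honest_node_send:
  assumes "0 < k"
  shows "node_send \<Lambda> w s k (received \<Lambda> w s t k) D = known t k D |` schedule (seen_from w s k) D (t + 1)"
  using assms by (simp add: node_send_def node_known_def knowledge_sharing_in_a_ring_def)

lemma honest_node_output:
  assumes "0 < k" "node_output \<Lambda> w s k (received \<Lambda> w s t k) = Some y"
  shows "N \<le> \<beta>" "on_schedule (seen_from w s k) (received \<Lambda> w s t k)"
    "secrets_match (seen_from w s k) (inputs w ! k) (coins w ! k) (received \<Lambda> w s t k)"
    "y = q (by_id (seen_from w s k) (\<lambda>i. the (known t k Cw (i, Reveal))))"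
  using assms
  by (auto simp: node_output_def node_known_def knowledge_sharing_in_a_ring_def split: if_splits)

section \<open>What honest agents retain and pass on\<close>

lemma known_take:
  assumes "on_schedule (seen_from w s k) (received \<Lambda> w s t' k)" "t \<le> t'"
    and "\<And>i. t \<le> i \<Longrightarrow> i < t' \<Longrightarrow> key \<notin> schedule (upstream_ring (seen_from w s k) D) D (i + 1)"
  shows "known t' k D key = known t k D key"
  using known_values_take[OF assms(1), of t key D] assms(2,3)
  by (simp add: node_known_def take_received)

text \<open>All shares are due by round \<open>N - 1\<close>, so an agent whose history is on
  schedule still holds at the end what it held then. This makes a secret binding before any input is
  revealed.\<close>

lemma known_share:
  assumes "on_schedule (seen_from w s k) (received \<Lambda> w s T k)" "\<kappa> \<noteq> Reveal"
  shows "known T k D (i, \<kappa>) = known (N - 1) k D (i, \<kappa>)"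
proof (rule known_take[OF assms(1)])
  fix t assume "N - 1 \<le> t"
  show "(i, \<kappa>) \<notin> schedule (upstream_ring (seen_from w s k) D) D (t + 1)"
  proof
    assume "(i, \<kappa>) \<in> schedule (upstream_ring (seen_from w s k) D) D (t + 1)"
    then obtain m where "m < hops N \<kappa> D" "send_round N \<kappa> D m = t + 1"
      by (auto simp: schedule_def)
    with send_round_share[OF this(1) assms(2) N_ge_2] \<open>N - 1 \<le> t\<close> show False by simp
  qed
qed simp

lemma known_own_reveal:
  assumes "on_schedule (seen_from w s k) (received \<Lambda> w s t k)" "0 < k" "k < n"
  shows "known t k Cw (ids w ! k, Reveal) = Some (inputs w ! k)"
proof -
  have "known t k Cw (ids w ! k, Reveal) = known 0 k Cw (ids w ! k, Reveal)"
    using own_not_scheduled_upstream[of "seen_from w s k"] seen_from_0[OF assms(2,3)] N_ge_2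
    by (intro known_take[OF assms(1)]) (auto simp del: upstream_ring.simps)
  then show ?thesis
    using seen_from_0[OF assms(2,3)] by (simp add: node_known_def own_values_def Let_def)
qed

text \<open>Node \<open>Suc k\<close> receives the input of \<open>i\<close> in exactly one inbox,
  from the honest node \<open>k\<close>, and neither copy changes afterwards. An agent does not
  receive its own input, hence the exception.\<close>

lemma known_reveal_step:
  assumes sched: "on_schedule (seen_from w s k) (received \<Lambda> w s T k)"
      "on_schedule (seen_from w s (Suc k)) (received \<Lambda> w s T (Suc k))"
    and k: "0 < k" "Suc k < n" and i: "i \<in> set E" "i \<noteq> ids w ! Suc k"
  shows "known T (Suc k) Cw (i, Reveal) = known T k Cw (i, Reveal)"
proof -
  let ?R = "seen_from w s (Suc k)"
  note up = upstream_seen_from[OF k(1)]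
  obtain m where m: "m < length ?R" "i = behind ?R Cw m"
    using i(1) by (metis ex_behind set_seen_from)
  have "m \<noteq> 0"
    using m(2) i(2) seen_from_0[of "Suc k"] k behind_0[of ?R Cw] N_ge_2 by (cases m) (auto simp: length_0_conv[symmetric] simp del: length_0_conv)
  then obtain m' where m': "m = Suc m'" by (cases m) auto
  have m'_less: "Suc m' < N" using m m' by simp
  \<comment> \<open>The agent at distance \<open>m'\<close> sends a revealed input on at round
    \<open>N + 1 + m'\<close>, which is entry \<open>N + m'\<close> of the history of the
    receiver.\<close>
  define t where "t = N + m'"
  have t: "t < T" using m'_less by (simp add: t_def)
  have here: "i = behind (seen_from w s k) Cw m'"
    using m m' behind_upstream_ring[of m' ?R Cw] up by simp
  have in_iff: "(i, Reveal) \<in> schedule (upstream_ring ?R Cw) Cw (t' + 1) \<longleftrightarrow> t' = t" for t'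
    using schedule_iff[of "seen_from w s k" m' Cw Reveal "t' + 1"] m'_less N_ge_2
    unfolding up here by (auto simp: send_round_def t_def)
  have "known T (Suc k) Cw (i, Reveal) = known (Suc t) (Suc k) Cw (i, Reveal)"
  proof (rule known_take[OF sched(2)])
    show "(i, Reveal) \<notin> schedule (upstream_ring ?R Cw) Cw (t' + 1)" if "Suc t \<le> t'" for t'
      using in_iff[of t'] that by simp
  qed (use t in simp)
  also have "\<dots> = known t k Cw (i, Reveal)"
  proof -
    have *: "(received \<Lambda> w s T (Suc k) ! t) Cw = known t k Cw |` schedule (seen_from w s k) Cw (t + 1)"
      using k unfolding received_nth[OF t] upstream_Cw_Suc[OF k(1) Suc_lessD[OF k(2)]]
      by (simp only: honest_node_send)
    have "received \<Lambda> w s (Suc t) (Suc k) =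
        received \<Lambda> w s t (Suc k) @ [received \<Lambda> w s T (Suc k) ! t]"
      using take_Suc_conv_app_nth[of t "received \<Lambda> w s T (Suc k)"] t
      by (simp add: take_received del: received.simps)
    then have "known (Suc t) (Suc k) Cw =
        known t (Suc k) Cw ++ (received \<Lambda> w s T (Suc k) ! t) Cw"
      by (simp add: node_known_def del: received.simps)
    moreover have "dom ((received \<Lambda> w s T (Suc k) ! t) Cw) = schedule (upstream_ring ?R Cw) Cw (t + 1)"
      using sched(2) t by (simp add: on_schedule_def)
    then have "(i, Reveal) \<in> dom ((received \<Lambda> w s T (Suc k) ! t) Cw)"
      using in_iff[of t] by blast
    moreover have "(i, Reveal) \<in> schedule (seen_from w s k) Cw (t + 1)"
      using in_iff[of t] unfolding up by blast
    ultimately show ?thesis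
      unfolding * by (simp add: map_add_dom_app_simps(1) del: received.simps)
  qed
  \<comment> \<open>Node \<open>k\<close> is the origin of the value or was due to receive it before
    sending it on; either way the value is not due to arrive again.\<close>
  also have "\<dots> = known T k Cw (i, Reveal)"
  proof (rule known_take[OF sched(1), symmetric])
    fix t' assume "t \<le> t'"
    show "(i, Reveal) \<notin> schedule (upstream_ring (seen_from w s k) Cw) Cw (t' + 1)"
    proof (cases "m' = 0")
      case True
      then have "i = seen_from w s k ! 0"
        using here N_ge_2 by (subst behind_0[symmetric, where D=Cw]) (auto simp: length_0_conv[symmetric] simp del: length_0_conv)
      then show ?thesis
        using own_not_scheduled_upstream[of "seen_from w s k"] N_ge_2 by (auto simp del: upstream_ring.simps)
    next
      case False
      then have "(i, Reveal) \<in> schedule (upstream_ring (seen_from w s k) Cw) Cw (t' + 1) \<longleftrightarrow>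
          m' \<le> hops N Reveal Cw \<and> send_round N Reveal Cw (m' - 1) = t' + 1"
        using schedule_upstream_iff[of "seen_from w s k" m' Cw Reveal "t' + 1"] m'_less N_ge_2
        unfolding here by simp
      then show ?thesis
        using False \<open>t \<le> t'\<close> by (simp add: send_round_def t_def)
    qed
  qed (use t in simp)
  finally show ?thesis .
qed

lemma known_reveal_chain:
  assumes sched: "\<And>k. 0 < k \<Longrightarrow> k < n \<Longrightarrow> on_schedule (seen_from w s k) (received \<Lambda> w s T k)"
    and k: "0 < k" "k \<le> k'" "k' < n" and i: "i \<in> set E" "\<And>j. k < j \<Longrightarrow> j \<le> k' \<Longrightarrow> i \<noteq> ids w ! j"
  shows "known T k' Cw (i, Reveal) = known T k Cw (i, Reveal)"
  using k(2,3) i(2)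
proof (induction k' rule: dec_induct)
  case (step k')
  have "known T (Suc k') Cw (i, Reveal) = known T k' Cw (i, Reveal)"
    using step k(1) i(1) by (intro known_reveal_step sched) auto
  also have "\<dots> = known T k Cw (i, Reveal)"
    using step by (intro step.IH) auto
  finally show ?case .
qed simp

text \<open>Node \<open>n - 1\<close> serves as the reference: all nodes from \<open>k\<close> to
  \<open>n - 1\<close> are honest, so the clockwise reveal gets there without passing the
  deviator.\<close>

lemma known_reveal_honest:
  assumes sched: "\<And>k. 0 < k \<Longrightarrow> k < n \<Longrightarrow> on_schedule (seen_from w s k) (received \<Lambda> w s T k)"
    and k: "0 < k" "k < n"
  shows "known T (n - 1) Cw (ids w ! k, Reveal) = Some (inputs w ! k)"
proof -
  have "ids w ! k \<in> set E"
    using E_nth_honest[OF k] length_E k nth_mem[of "d + k - 1" E] by simp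
  moreover have "ids w ! k \<noteq> ids w ! j" if "k < j" "j \<le> n - 1" for j
    using fakes that k by (simp add: ring_with_fakes_def proper_world_def nth_eq_iff_index_eq)
  ultimately have "known T (n - 1) Cw (ids w ! k, Reveal) = known T k Cw (ids w ! k, Reveal)"
    using k by (intro known_reveal_chain[OF sched]) auto
  then show ?thesis
    using known_own_reveal[OF sched[OF k] k] by simp
qed

text \<open>The target of the second secret of fake agent \<open>j\<close> is real because of
  \<open>d < n\<close>. Its check equates the revealed input with the commitment, and honest nodes
  carry that input unchanged from the target to node \<open>n - 1\<close>.\<close>

lemma known_reveal_fake:
  assumes sched: "\<And>k. 0 < k \<Longrightarrow> k < n \<Longrightarrow> on_schedule (seen_from w s k) (received \<Lambda> w s T k)"
    and secrets: "\<And>k. 0 < k \<Longrightarrow> k < n \<Longrightarrow>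
      secrets_match (seen_from w s k) (inputs w ! k) (coins w ! k) (received \<Lambda> w s T k)"
    and d: "d < n" and j: "j < d"
  shows "the (known T (n - 1) Cw (E ! j, Reveal)) = commitment \<beta> q w s j"
proof -
  define h where "h = N - N div 2"
  define k where "k = checker N d j"
  \<comment> \<open>From \<open>d < n\<close> follows \<open>N = d + n - 1 \<ge> 2 * d\<close>,
    whence \<open>d \<le> N div 2\<close>.\<close>
  have h: "d \<le> N div 2" "d \<le> h" "h + N div 2 = N" "N div 2 \<le> h" "h < N"
    using d length_E d_pos N_ge_2 by (auto simp: h_def)
  \<comment> \<open>The second target lies \<open>h\<close> hops clockwise from position
    \<open>j\<close> of the enlarged ring, and node \<open>k\<close> is at position
    \<open>d + k - 1\<close>.\<close>
  have kh: "d + k - 1 = h + j"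
    using h j by (simp add: k_def checker_def h_def)
  have "k = h + j + 1 - d" "h + j < N"
    using h j by (simp_all add: k_def checker_def h_def)
  then have k: "0 < k" "k < n"
    using h(2) length_E d_pos n_ge_2 by linarith+
  have "behind (seen_from w s k) Cw h = E ! ((h + j + (N - h)) mod N)"
    unfolding seen_from_def kh using h j N_ge_2 by (intro behind_rotate_Cw) auto
  also have "h + j + (N - h) = N + j"
    using h by simp
  also have "(N + j) mod N = j"
  proof -
    have "j < N" using j length_E n_ge_2 by linarith
    then show ?thesis by simp
  qed
  finally have target: "behind (seen_from w s k) Cw h = E ! j" .
  have "the (known T k Ccw (E ! j, Share2)) - the (known T k Cw (E ! j, Share2)) =
      the (known T k Cw (E ! j, Reveal))"
    using secrets[OF k] target
    by (simp add: secrets_match_def Let_def node_known_def h_def del: behind.simps)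
  then have "commitment \<beta> q w s j = the (known T k Cw (E ! j, Reveal))"
    using known_share[OF sched[OF k], of Share2]
    by (simp add: commitment_def Let_def k_def)
  moreover have "known T (n - 1) Cw (E ! j, Reveal) = known T k Cw (E ! j, Reveal)"
  proof (rule known_reveal_chain[OF sched])
    show "E ! j \<in> set E" using j length_E n_ge_2 by (intro nth_mem) linarith
    fix l assume l: "k < l" "l \<le> n - 1"
    then have "0 < l" "l < n" using n_ge_2 by auto
    then show "E ! j \<noteq> ids w ! l"
      using j length_E distinct_E unfolding E_nth_honest[OF \<open>0 < l\<close> \<open>l < n\<close>, symmetric]
      by (subst nth_eq_iff_index_eq) auto
  qed (use k in auto)
  ultimately show ?thesis by simp
qed

section \<open>What a successful outcome implies\<close>

lemma utility_eq_0_if_too_long: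
  assumes "\<beta> < N"
  shows "utility p (outcome \<Lambda> w s) = 0"
proof (rule ccontr)
  assume "utility p (outcome \<Lambda> w s) \<noteq> 0"
  then obtain y where y: "\<forall>x \<in> set (outcome \<Lambda> w s). x = Some y"
    by (auto simp: utility_def legal_def split: if_splits)
  have "1 < length (outcome \<Lambda> w s)" using n_ge_2 by (simp add: outcome_def)
  with y have "outcome \<Lambda> w s ! 1 = Some y" by (metis nth_mem)
  then have "node_output \<Lambda> w s 1 (received \<Lambda> w s (last_round \<Lambda> N - 1) 1) = Some y"
    using n_ge_2 by (simp add: outcome_def del: received.simps)
  from honest_node_output(1)[OF _ this] assms show False by simp
qed

text \<open>In a success node \<open>n - 1\<close> outputs \<open>p\<close> as well. It has been
  told the true inputs of the honest nodes and the committed inputs of the fake ones, so these alone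
  determine its output.\<close>

lemma committed_inputs_value:
  assumes "utility p (outcome \<Lambda> w s) \<noteq> 0" and d: "d < n"
  shows "q (by_id E (value_at E (committed_inputs \<beta> q w s))) = p"
    and "\<And>j. j < d \<Longrightarrow> the (known T (n - 1) Cw (E ! j, Reveal)) = commitment \<beta> q w s j"
proof -
  obtain y where y: "\<forall>x \<in> set (outcome \<Lambda> w s). x = Some y" "outcome \<Lambda> w s ! 0 = Some p"
    using assms(1) by (auto simp: utility_def legal_def split: if_splits)
  have len: "length (outcome \<Lambda> w s) = n" by (simp add: outcome_def)
  with y n_ge_2 have "y = p" by (metis nth_mem option.inject less_le_trans zero_less_numeral)
  have out: "node_output \<Lambda> w s k (received \<Lambda> w s T k) = Some p" if "k < n" for k
  proof -
    have "outcome \<Lambda> w s ! k = Some p"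
      using y(1) len that \<open>y = p\<close> by (metis nth_mem)
    moreover have "last_round \<Lambda> N - 1 = T"
      by (simp add: knowledge_sharing_in_a_ring_def)
    ultimately show ?thesis
      using that by (simp add: outcome_def)
  qed
  note sched = honest_node_output(2)[OF _ out]
  note secrets = honest_node_output(3)[OF _ out]
  show fake: "the (known T (n - 1) Cw (E ! j, Reveal)) = commitment \<beta> q w s j" if "j < d" for j
    by (rule known_reveal_fake[OF sched secrets d that])
  have n: "0 < n - 1" "n - 1 < n" using n_ge_2 by auto
  have len_inputs: "length (inputs w) = n"
    using fakes by (simp add: ring_with_fakes_def proper_world_def)
  have len_committed: "N = length (committed_inputs \<beta> q w s)"
    using length_E len_inputs n_ge_2 by (simp add: committed_inputs_def)
  have "the (known T (n - 1) Cw (i, Reveal)) = value_at E (committed_inputs \<beta> q w s) i"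
    if i: "i \<in> set E" for i
  proof -
    obtain l where l: "l < N" "i = E ! l" using i by (auto simp: in_set_conv_nth)
    have v: "value_at E (committed_inputs \<beta> q w s) i = committed_inputs \<beta> q w s ! l"
      unfolding l(2) by (rule value_at_nth[OF distinct_E len_committed l(1)])
    show ?thesis
    proof (cases "l < d")
      case True
      then show ?thesis
        using fake[OF True] unfolding v by (simp add: committed_inputs_def nth_append l(2))
    next
      case False
      define k where "k = l - d + 1"
      have k: "0 < k" "k < n" "d + k - 1 = l"
        using False l length_E by (auto simp: k_def)
      have "known T (n - 1) Cw (i, Reveal) = Some (inputs w ! k)"
        using known_reveal_honest[OF sched k(1,2)] E_nth_honest[OF k(1,2)] k(3) l(2) by simp
      moreover have "committed_inputs \<beta> q w s ! l = inputs w ! k"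
        using False k len_inputs by (simp add: committed_inputs_def nth_append nth_tl k_def)
      ultimately show ?thesis unfolding v by simp
    qed
  qed
  then have "by_id (seen_from w s (n - 1)) (\<lambda>i. the (known T (n - 1) Cw (i, Reveal))) =
      by_id E (value_at E (committed_inputs \<beta> q w s))"
    using distinct_E by (intro by_id_cong) auto
  then show "q (by_id E (value_at E (committed_inputs \<beta> q w s))) = p"
    using honest_node_output(4)[OF n(1) out[OF n(2)]] by simp
qed

end

section \<open>Shifting the last input\<close>

text \<open>The last node is the counter-clockwise neighbor of the deviator. The change preserves
  \<open>fst c + x\<close>, the counter-clockwise part of its first secret, and
  \<open>snd c\<close>, the clockwise part of its second.\<close>

definition shift_last ::
    "'x::ab_group_add \<Rightarrow> ('x, 'x \<times> 'x, 'y) world \<Rightarrow> ('x, 'x \<times> 'x, 'y) world" where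
  "shift_last \<delta> w = (let l = ring_size w - 1 in
     w\<lparr>inputs := (inputs w)[l := inputs w ! l + \<delta>],
       coins := (coins w)[l := (fst (coins w ! l) - \<delta>, snd (coins w ! l))]\<rparr>)"

lemma ids_shift_last [simp]: "ids (shift_last \<delta> w) = ids w"
  and prefs_shift_last [simp]: "prefs (shift_last \<delta> w) = prefs w"
  and inputs_shift_last:
    "inputs (shift_last \<delta> w) = (inputs w)[ring_size w - 1 := inputs w ! (ring_size w - 1) + \<delta>]"
  and coins_shift_last: "coins (shift_last \<delta> w) = (coins w)[ring_size w - 1 :=
    (fst (coins w ! (ring_size w - 1)) - \<delta>, snd (coins w ! (ring_size w - 1)))]"
  by (simp_all add: shift_last_def Let_def)

lemma shift_last_other:
  assumes "k \<noteq> ring_size w - 1"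
  shows "inputs (shift_last \<delta> w) ! k = inputs w ! k" "coins (shift_last \<delta> w) ! k = coins w ! k"
  using assms by (simp_all add: inputs_shift_last coins_shift_last)

lemma proper_world_shift_last [simp]: "proper_world (shift_last \<delta> w) \<longleftrightarrow> proper_world w"
  by (simp add: proper_world_def inputs_shift_last coins_shift_last)

lemma enlarged_ring_shift_last [simp]: "enlarged_ring (shift_last \<delta> w) s = enlarged_ring w s"
  by (simp add: enlarged_ring_def)

lemma seen_from_shift_last [simp]: "seen_from (shift_last \<delta> w) s k = seen_from w s k"
  by (simp add: seen_from_def)

lemma ring_with_fakes_shift_last [simp]: "ring_with_fakes (shift_last \<delta> w) s \<longleftrightarrow> ring_with_fakes w s"
  by (simp add: ring_with_fakes_def)

lemma follow_shift_last:
  assumes "2 \<le> ring_size w"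
  shows "follow \<Lambda> (shift_last \<delta> w) = follow \<Lambda> w"
  using assms by (simp add: follow_def shift_last_other)

text \<open>
  The shift changes the clockwise part of the first secret but the counter-clockwise part of the
  second one, because these are the parts that reach the deviator only after round \<open>N - 1\<close>, if at all.
\<close>

fun hidden_keys :: "nat \<Rightarrow> direction \<Rightarrow> (nat \<times> kind) set" where
  "hidden_keys i Cw = {(i, Share1), (i, Reveal)}"
| "hidden_keys i Ccw = {(i, Share2)}"

locale shifted_deviation =
  fixes \<beta> :: nat and q :: "'x::ab_group_add list \<Rightarrow> 'y" and w :: "('x, 'x \<times> 'x, 'y) world"
    and s :: "('x message, 'y) strategy" and \<delta> :: 'x
  assumes fakes: "ring_with_fakes w s" and few: "length (names s) < ring_size w"
begin

abbreviation (input) "\<Lambda> \<equiv> knowledge_sharing_in_a_ring \<beta> q"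
abbreviation (input) "n \<equiv> ring_size w"
abbreviation (input) "d \<equiv> length (names s)"
abbreviation (input) "E \<equiv> enlarged_ring w s"
abbreviation (input) "N \<equiv> length E"
abbreviation (input) "w' \<equiv> shift_last \<delta> w"
abbreviation (input) "hidden \<equiv> hidden_keys (ids w ! (n - 1))"

lemma fakes': "ring_with_fakes w' s"
  using fakes by simp

lemma own_values_shift_last:
  assumes "0 < k" "k < n" "key \<notin> hidden D"
  shows "own_values (seen_from w s k) (inputs w' ! k) (coins w' ! k) D key =
    own_values (seen_from w s k) (inputs w ! k) (coins w ! k) D key"
proof (cases "k = n - 1")
  case True
  have "length (inputs w) = n" "length (coins w) = n"
    using fakes by (auto simp: ring_with_fakes_def proper_world_def)
  then show ?thesis
    using True assms seen_from_0[OF fakes assms(1,2)]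
    by (cases D) (auto simp: own_values_def Let_def inputs_shift_last coins_shift_last add_ac)
next
  case False
  then show ?thesis by (simp add: shift_last_other)
qed

text \<open>Clockwise, \<open>Share1\<close> makes a single hop and waits until round
  \<open>N - 1\<close>, and \<open>Reveal\<close> starts at round \<open>N + 1\<close>. If node 1
  sends the counter-clockwise \<open>Share2\<close> at all, it is the agent just before the target
  and waits as well.\<close>

lemma hidden_not_scheduled:
  assumes "key \<in> hidden D" "t + 1 \<le> N - 2"
  shows "0 < upstream n D 0" "upstream n D 0 < n"
    "key \<notin> schedule (seen_from w s (upstream n D 0)) D (t + 1)"
proof -
  note n = n_ge_2[OF fakes] and d = d_pos[OF fakes] and N = length_E[OF fakes] and N2 = N_ge_2[OF fakes]
  have up: "upstream n Cw 0 = n - 1" "upstream n Ccw 0 = 1" using n by simp_all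
  then show "0 < upstream n D 0" "upstream n D 0 < n" using n by (cases D; simp)+
  show "key \<notin> schedule (seen_from w s (upstream n D 0)) D (t + 1)"
  proof (cases D)
    case Cw
    have "ids w ! (n - 1) = behind (seen_from w s (n - 1)) Cw 0"
      using seen_from_0[OF fakes, of "n - 1"] n by simp
    then obtain \<kappa> where \<kappa>: "key = (behind (seen_from w s (n - 1)) Cw 0, \<kappa>)" "\<kappa> = Share1 \<or> \<kappa> = Reveal"
      using assms(1) unfolding Cw by auto
    have "send_round N \<kappa> Cw 0 \<noteq> t + 1"
      using \<kappa>(2) assms(2) N2 by (auto simp: send_round_def)
    moreover have "0 < N" using N2 by linarith
    ultimately show ?thesis
      using schedule_iff[of "seen_from w s (n - 1)" 0 Cw \<kappa> "t + 1"] fakes N2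
      unfolding Cw up \<kappa>(1) by (simp add: distinct_seen_from length_seen_from del: behind.simps)
  next
    case Ccw
    let ?R = "seen_from w s 1"
    have "ids w ! (n - 1) = E ! (N - 1)"
    proof -
      have "d + (n - 1) - 1 = N - 1" using N n d by linarith
      then show ?thesis using E_nth_honest[OF fakes, of "n - 1"] n by simp
    qed
    \<comment> \<open>Node 1 is at position \<open>d\<close> of the enlarged ring and the last node
      at position \<open>N - 1\<close>.\<close>
    also have "\<dots> = behind ?R Ccw (N - 1 - d)"
    proof -
      have "N - 1 - d < N" "d + (N - 1 - d) = N - 1" "N - 1 < N" "d + 1 - 1 = d"
        using n N d N2 by linarith+
      then show ?thesis
        unfolding seen_from_def behind.simps length_rotate by (simp only: nth_rotate mod_less)
    qed
    finally have e: "ids w ! (n - 1) = behind ?R Ccw (N - 1 - d)" .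
    show ?thesis
    proof
      assume "key \<in> schedule (seen_from w s (upstream n D 0)) D (t + 1)"
      then have "N - 1 - d < N div 2" "send_round N Share2 Ccw (N - 1 - d) = t + 1"
        using assms(1) schedule_iff[of ?R "N - 1 - d" Ccw Share2 "t + 1"] fakes N2 d
        unfolding Ccw up e by (auto simp: distinct_seen_from length_seen_from simp del: behind.simps)
      \<comment> \<open>From \<open>d < n\<close> follows
        \<open>N - d = n - 1 \<ge> N div 2\<close>. So node 1 can be on the path only with equality,
        that is, just before the target.\<close>
      moreover from this(1) have "N - 1 - d + 1 = N div 2"
        using few N n d by linarith
      ultimately have "t + 1 = N - 1"
        by (simp add: send_round_def)
      then show False using assms(2) N2 by linarith
    qed
  qed
qed

text \<open>The two claims need each other: honest nodes react to the deviator, and the deviator to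
  what leaves the honest arc. Differences between the worlds stay within the hidden keys, which the
  two real nodes next to the deviator do not send before round \<open>N - 1\<close>.\<close>

lemma received_shift_last_aux:
  assumes "t \<le> N - 2"
  shows "received \<Lambda> w' s t 0 = received \<Lambda> w s t 0 \<and> (\<forall>j < n. \<forall>D key. key \<notin> hidden D \<longrightarrow>
    node_send \<Lambda> w' s j (received \<Lambda> w' s t j) D key = node_send \<Lambda> w s j (received \<Lambda> w s t j) D key)"
  using assms
proof (induction t rule: less_induct)
  case (less t)
  note n = n_ge_2[OF fakes]
  have "received \<Lambda> w' s t 0 ! t' = received \<Lambda> w s t 0 ! t'" if t': "t' < t" for t'
  proof (intro ext)
    fix D key
    let ?j = "upstream n D 0"
    have "?j < n" using n by (intro upstream_less) linarith
    have "node_send \<Lambda> w' s ?j (received \<Lambda> w' s t' ?j) D key =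
        node_send \<Lambda> w s ?j (received \<Lambda> w s t' ?j) D key"
    proof (cases "key \<in> hidden D")
      case True
      have "t' + 1 \<le> N - 2" using t' less.prems by simp
      note * = hidden_not_scheduled[OF True this]
      show ?thesis
        unfolding honest_node_send[OF fakes *(1)] honest_node_send[OF fakes' *(1)]
        using *(3) by simp
    next
      case False
      have "t' \<le> N - 2" using less.prems t' by linarith
      with less.IH[OF t'] \<open>?j < n\<close> False show ?thesis by blast
    qed
    then show "(received \<Lambda> w' s t 0 ! t') D key = (received \<Lambda> w s t 0 ! t') D key"
      unfolding received_nth[OF t'] by simp
  qed
  then have hist: "received \<Lambda> w' s t 0 = received \<Lambda> w s t 0"
    by (intro nth_equalityI) simp_all
  moreover have "node_send \<Lambda> w' s j (received \<Lambda> w' s t j) D key = node_send \<Lambda> w s j (received \<Lambda> w s t j) D key"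
    if j: "j < n" and key: "key \<notin> hidden D" for j D key
  proof (cases "j = 0")
    case True
    then show ?thesis using hist by (simp add: node_send_def)
  next
    case False
    then have "0 < j" by simp
    have "(received \<Lambda> w' s t j ! t') D key = (received \<Lambda> w s t j ! t') D key" if t': "t' < t" for t'
    proof -
      have "t' \<le> N - 2" "upstream n D j < n"
        using less.prems t' upstream_less[of n D j] n by linarith+
      from less.IH[OF t' this(1), THEN conjunct2, rule_format, OF this(2) key] show ?thesis
        unfolding received_nth[OF t'] by simp
    qed
    then have "node_known \<beta> q w' s t j D key = node_known \<beta> q w s t j D key"
      unfolding node_known_def seen_from_shift_last
      by (intro known_values_cong own_values_shift_last[OF \<open>0 < j\<close> j key]) simp_all
    then show ?thesis
      unfolding honest_node_send[OF fakes \<open>0 < j\<close>] honest_node_send[OF fakes' \<open>0 < j\<close>]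
      by (simp add: restrict_map_def)
  qed
  ultimately show ?case by blast
qed

lemmas received_shift_last = received_shift_last_aux[THEN conjunct1]

lemma node_send_shift_last:
  assumes "t \<le> N - 2" "j < n" "key \<notin> hidden D"
  shows "node_send \<Lambda> w' s j (received \<Lambda> w' s t j) D key = node_send \<Lambda> w s j (received \<Lambda> w s t j) D key"
  using received_shift_last_aux[OF assms(1)] assms(2,3) by blast

text \<open>This reaches one entry further than the result for the deviator: messages of round
  \<open>N - 1\<close> are based on histories of length \<open>N - 2\<close>, so outside the hidden
  keys they still agree.\<close>

lemma node_known_shift_last:
  assumes "t \<le> N - 1" "0 < k" "k < n" "key \<notin> hidden D"
  shows "node_known \<beta> q w' s t k D key = node_known \<beta> q w s t k D key"
proof -
  have "(received \<Lambda> w' s t k ! t') D key = (received \<Lambda> w s t k ! t') D key" if t': "t' < t" for t'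
  proof -
    have "t' \<le> N - 2" "upstream n D k < n"
      using assms(1,3) t' upstream_less[of n D k] by linarith+
    with node_send_shift_last[OF this assms(4)] show ?thesis
      unfolding received_nth[OF t'] by simp
  qed
  then show ?thesis
    unfolding node_known_def seen_from_shift_last
    by (intro known_values_cong own_values_shift_last[OF assms(2-4)]) simp_all
qed

text \<open>The shares of a fake agent are not among the hidden keys, and its checker is honest. So
  the commitment is made without any information about the last input.\<close>

lemma commitment_shift_last:
  assumes j: "j < d"
  shows "commitment \<beta> q w' s j = commitment \<beta> q w s j"
proof -
  note n = n_ge_2[OF fakes] and N = length_E[OF fakes]
  have "E ! j \<noteq> ids w ! (n - 1)"
    using j few N n unfolding E_nth_honest[OF fakes, of "n - 1", symmetric, simplified]
    by (subst E_nth_honest[OF fakes, symmetric]; simp add: nth_eq_iff_index_eq[OF distinct_E[OF fakes]])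
  then have hidden: "(E ! j, Share2) \<notin> hidden D" for D by (cases D) auto
  have "0 < checker N d j" "checker N d j < n"
    using few j N unfolding checker_def by linarith+
  from node_known_shift_last[OF order.refl this hidden] show ?thesis
    by (simp only: commitment_def Let_def enlarged_ring_shift_last)
qed

text \<open>The form needed for averaging over \<delta>: the last argument of \<open>q\<close>
  varies freely while the others stay fixed.\<close>

lemma committed_inputs_shift_last:
  "committed_inputs \<beta> q w' s = (committed_inputs \<beta> q w s)[N - 1 := committed_inputs \<beta> q w s ! (N - 1) + \<delta>]"
proof (rule nth_equalityI)
  note n = n_ge_2[OF fakes] and N = length_E[OF fakes] and d = d_pos[OF fakes]
  have len: "length (inputs w) = n"
    using fakes by (simp add: ring_with_fakes_def proper_world_def)
  show "length (committed_inputs \<beta> q w' s) =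
      length ((committed_inputs \<beta> q w s)[N - 1 := committed_inputs \<beta> q w s ! (N - 1) + \<delta>])"
    by (simp add: committed_inputs_def inputs_shift_last)
  fix i assume "i < length (committed_inputs \<beta> q w' s)"
  then have i: "i < N" using N n len by (simp add: committed_inputs_def inputs_shift_last)
  show "committed_inputs \<beta> q w' s ! i =
      (committed_inputs \<beta> q w s)[N - 1 := committed_inputs \<beta> q w s ! (N - 1) + \<delta>] ! i"
  proof (cases "i < d")
    case True
    then show ?thesis
      using N n by (simp add: committed_inputs_def nth_append commitment_shift_last)
  next
    case False
    then have "Suc (i - d) < n" using i N by linarith
    moreover have "i = N - 1 \<longleftrightarrow> Suc (i - d) = n - 1" using i False N n d by linarith
    ultimately show ?thesis
      using False i N n d len
      by (cases "i = N - 1") (auto simp: committed_inputs_def nth_append nth_tl inputs_shift_last)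
  qed
qed

end

lemmas received_shift_last = shifted_deviation.received_shift_last[OF shifted_deviation.intro]
lemmas committed_inputs_shift_last =
  shifted_deviation.committed_inputs_shift_last[OF shifted_deviation.intro]

section \<open>Averaging over the last input\<close>

text \<open>Two fibres of equal size, one for each element of the range, halve the set of
  inputs.\<close>

lemma full_knowledge_half:
  fixes q :: "'x::finite list \<Rightarrow> 'y"
  assumes "knowledge_sharing_function 2 q" "j < length xs" "y \<in> range q"
  shows "2 * card {x. q (xs[j := x]) = y} = CARD('x)"
proof -
  have "card (range q) = 2" "full_knowledge q"
    using assms(1) by (simp_all add: knowledge_sharing_function_def)
  then obtain a b where ab: "range q = {a, b}" "a \<noteq> b"
    by (auto simp: card_2_iff)
  have eq: "card {x. q (xs[j := x]) = z} = card {x. q (xs[j := x]) = y}" if "z \<in> range q" for z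
    using \<open>full_knowledge q\<close> assms(2,3) that unfolding full_knowledge_def by blast
  have "q (xs[j := x]) = a \<or> q (xs[j := x]) = b" for x
    using ab(1) by blast
  then have "UNIV = {x. q (xs[j := x]) = a} \<union> {x. q (xs[j := x]) = b}"
    by auto
  then have "CARD('x) = card {x. q (xs[j := x]) = a} + card {x. q (xs[j := x]) = b}"
    using ab(2) by (subst card_Un_disjoint[symmetric]) auto
  then show ?thesis
    using eq[of a] eq[of b] ab(1) by simp
qed

text \<open>Full Knowledge speaks of a position in the argument list of \<open>q\<close>, which is
  ordered by id. The index \<open>j\<close> is where sorting puts the id at ring position
  \<open>l\<close>; it does not depend on \<open>v\<close>.\<close>

lemma by_id_update:
  assumes "distinct R" "length R = length vs" "l < length R"
  obtains j where "j < length R"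
    "\<And>v. by_id R (value_at R (vs[l := v])) = (by_id R (value_at R vs))[j := v]"
proof -
  have "R ! l \<in> set (sort R)" using assms(3) by simp
  then obtain j where j: "j < length R" "sort R ! j = R ! l"
    unfolding in_set_conv_nth by auto
  show thesis
  proof (rule that[OF j(1)])
    fix v
    show "by_id R (value_at R (vs[l := v])) = (by_id R (value_at R vs))[j := v]"
    proof (rule nth_equalityI)
      fix i assume "i < length (by_id R (value_at R (vs[l := v])))"
      then have i: "i < length R" by (simp add: by_id_def)
      then have "sort R ! i \<in> set R"
        by (metis length_sort nth_mem set_sort)
      then obtain m where m: "m < length R" "sort R ! i = R ! m"
        unfolding in_set_conv_nth by auto
      have "i = j \<longleftrightarrow> sort R ! i = sort R ! j"
        using assms(1) i j(1) by (simp add: nth_eq_iff_index_eq)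
      also have "\<dots> \<longleftrightarrow> m = l"
        using assms m j(2) by (simp add: nth_eq_iff_index_eq)
      finally have "i = j \<longleftrightarrow> m = l" .
      then show "by_id R (value_at R (vs[l := v])) ! i = (by_id R (value_at R vs))[j := v] ! i"
        using assms i m by (cases "m = l") (auto simp: by_id_def value_at_nth nth_list_update)
    qed (simp add: by_id_def)
  qed
qed

lemma shift_half:
  fixes q :: "'x::{finite, ab_group_add} list \<Rightarrow> 'y"
  assumes "knowledge_sharing_function 2 q" "y \<in> range q"
    and "distinct R" "length R = length vs" "l < length R"
  shows "2 * card {\<delta>. q (by_id R (value_at R (vs[l := vs ! l + \<delta>]))) = y} = CARD('x)"
proof -
  obtain j where j: "j < length R"
    "\<And>v. by_id R (value_at R (vs[l := v])) = (by_id R (value_at R vs))[j := v]"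
    using by_id_update[OF assms(3-5)] by blast
  let ?P = "\<lambda>x. q ((by_id R (value_at R vs))[j := x]) = y"
  have "bij_betw (\<lambda>\<delta>. vs ! l + \<delta>) {\<delta>. ?P (vs ! l + \<delta>)} {x. ?P x}"
    by (rule bij_betw_byWitness[where f' = "\<lambda>x. x - vs ! l"]) auto
  then have "card {\<delta>. ?P (vs ! l + \<delta>)} = card {x. ?P x}"
    by (rule bij_betw_same_card)
  moreover have "2 * card {x. ?P x} = CARD('x)"
    by (rule full_knowledge_half[OF assms(1) _ assms(2)]) (simp add: by_id_def j(1))
  ultimately show ?thesis by (simp add: j(2))
qed

lemma ring_size_pos: "proper_world w \<Longrightarrow> 0 < ring_size w"
  by (auto simp: proper_world_def)

section \<open>Counting worlds by shifts\<close>

lemma shift_last_inverse: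
  assumes "proper_world w"
  shows "shift_last (- \<delta>) (shift_last \<delta> w) = w"
proof -
  have "ring_size w - 1 < length (inputs w)" "ring_size w - 1 < length (coins w)"
    using assms ring_size_pos[OF assms] by (simp_all add: proper_world_def)
  then show ?thesis
    by (simp add: shift_last_def Let_def)
qed

text \<open>Double counting of pairs of a world and a shift: every shift permutes \<open>V\<close>,
  so the number of worlds satisfying \<open>f\<close> after it is always the same, while each world
  satisfies \<open>f\<close> after half of the shifts.\<close>

lemma shift_invariant_half:
  fixes V :: "('x::{finite, ab_group_add}, 'x \<times> 'x, 'y) world set"
  assumes "finite V" "\<And>w. w \<in> V \<Longrightarrow> proper_world w"
    and closed: "\<And>w \<delta>. w \<in> V \<Longrightarrow> shift_last \<delta> w \<in> V"
    and half: "\<And>w. w \<in> V \<Longrightarrow> 2 * card {\<delta>. f (shift_last \<delta> w)} = CARD('x)"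
  shows "2 * card {w \<in> V. f w} = card V"
proof -
  have "card {w \<in> V. f (shift_last \<delta> w)} = card {w \<in> V. f w}" for \<delta>
  proof (rule bij_betw_same_card, rule bij_betw_byWitness[where f = "shift_last \<delta>" and f' = "shift_last (- \<delta>)"])
    show "\<forall>w \<in> {w \<in> V. f (shift_last \<delta> w)}. shift_last (- \<delta>) (shift_last \<delta> w) = w"
      using assms(2) shift_last_inverse by blast
    show "\<forall>w \<in> {w \<in> V. f w}. shift_last \<delta> (shift_last (- \<delta>) w) = w"
      using assms(2) shift_last_inverse[of _ "- \<delta>"] by auto
    then show "shift_last (- \<delta>) ` {w \<in> V. f w} \<subseteq> {w \<in> V. f (shift_last \<delta> w)}"
      using closed by auto
    show "shift_last \<delta> ` {w \<in> V. f (shift_last \<delta> w)} \<subseteq> {w \<in> V. f w}"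
      using closed by auto
  qed
  then have "CARD('x) * card {w \<in> V. f w} = (\<Sum>\<delta>::'x\<in>UNIV. card {w \<in> V. f (shift_last \<delta> w)})"
    by simp
  also have "\<dots> = (\<Sum>\<delta>::'x\<in>UNIV. \<Sum>w\<in>V. of_bool (f (shift_last \<delta> w)))"
    using assms(1) by (simp add: sum.If_cases of_bool_def Int_def)
  also have "\<dots> = (\<Sum>w\<in>V. \<Sum>\<delta>::'x\<in>UNIV. of_bool (f (shift_last \<delta> w)))"
    by (rule sum.swap)
  also have "\<dots> = (\<Sum>w\<in>V. card {\<delta>. f (shift_last \<delta> w)})"
    by (simp add: sum.If_cases of_bool_def)
  finally have "CARD('x) * (2 * card {w \<in> V. f w}) = (\<Sum>w\<in>V. 2 * card {\<delta>. f (shift_last \<delta> w)})"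
    by (simp flip: sum_distrib_left)
  also have "\<dots> = card V * CARD('x)"
    using half by simp
  finally show ?thesis by simp
qed

lemma utility_follow:
  assumes "proper_world w" "ring_size w \<le> \<beta>"
  shows "utility p (outcome (knowledge_sharing_in_a_ring \<beta> q) w (follow (knowledge_sharing_in_a_ring \<beta> q) w)) =
    of_bool (q (by_id (ids w) (value_at (ids w) (inputs w))) = p)"
proof -
  have "0 < ring_size w" using assms(1) by (rule ring_size_pos)
  moreover have "correct_output q w = q (by_id (ids w) (value_at (ids w) (inputs w)))"
    by (simp add: correct_output_def value_at_def[abs_def])
  ultimately show ?thesis
    unfolding outcome_follow[OF assms] by (auto simp: utility_def legal_def)
qed

lemma utility_nonneg: "0 \<le> utility p out" and utility_le_1: "utility p out \<le> 1"
  by (simp_all add: utility_def)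

lemma sum_utility_follow:
  fixes q :: "'x::{finite, ab_group_add} list \<Rightarrow> 'y" and V :: "('x, 'x \<times> 'x, 'y) world set"
  assumes q: "knowledge_sharing_function 2 q" "p \<in> range q"
    and V: "finite V" "\<And>w. w \<in> V \<Longrightarrow> proper_world w" "\<And>w. w \<in> V \<Longrightarrow> ring_size w \<le> \<beta>"
      "\<And>w \<delta>. w \<in> V \<Longrightarrow> shift_last \<delta> w \<in> V"
  shows "(\<Sum>w\<in>V. utility p (outcome (knowledge_sharing_in_a_ring \<beta> q) w
    (follow (knowledge_sharing_in_a_ring \<beta> q) w))) = card V / 2"
proof -
  let ?f = "\<lambda>w :: ('x, 'x \<times> 'x, 'y) world. q (by_id (ids w) (value_at (ids w) (inputs w))) = p"
  have "2 * card {w \<in> V. ?f w} = card V"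
  proof (rule shift_invariant_half[OF V(1,2,4)])
    fix w assume "w \<in> V"
    from V(2)[OF this] show "2 * card {\<delta>. ?f (shift_last \<delta> w)} = CARD('x)"
      using shift_half[OF q, of "ids w" "inputs w" "ring_size w - 1"] ring_size_pos[OF V(2)[OF \<open>w \<in> V\<close>]]
      by (simp add: inputs_shift_last proper_world_def)
  qed
  moreover have "(\<Sum>w\<in>V. utility p (outcome (knowledge_sharing_in_a_ring \<beta> q) w
      (follow (knowledge_sharing_in_a_ring \<beta> q) w))) = (\<Sum>w\<in>V. of_bool (?f w))"
    using V by (intro sum.cong utility_follow) auto
  moreover have "\<dots> = real (card {w \<in> V. ?f w})"
    using V(1) by (simp add: sum.If_cases of_bool_def Int_def)
  ultimately show ?thesis by simp
qed

text \<open>Success implies that \<open>q\<close> maps the committed inputs to \<open>p\<close>,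
  which by the shift argument happens in half of the worlds. \<open>S\<close> is invariant under
  shifts, as the deviator cannot adapt to a change that it does not see.\<close>

lemma sum_utility_deviation:
  fixes q :: "'x::{finite, ab_group_add} list \<Rightarrow> 'y" and V :: "('x, 'x \<times> 'x, 'y) world set"
  assumes q: "knowledge_sharing_function 2 q" "p \<in> range q"
    and V: "finite V" "\<And>w \<delta>. w \<in> V \<Longrightarrow> shift_last \<delta> w \<in> V"
    and S: "\<And>w. w \<in> V \<Longrightarrow> ring_with_fakes w (S w)" "\<And>w. w \<in> V \<Longrightarrow> length (names (S w)) < ring_size w"
      "\<And>w \<delta>. w \<in> V \<Longrightarrow> S (shift_last \<delta> w) = S w"
  shows "(\<Sum>w\<in>V. utility p (outcome (knowledge_sharing_in_a_ring \<beta> q) w (S w))) \<le> card V / 2"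
proof -
  let ?v = "\<lambda>w. value_at (enlarged_ring w (S w)) (committed_inputs \<beta> q w (S w))"
  let ?f = "\<lambda>w. q (by_id (enlarged_ring w (S w)) (?v w)) = p"
  have proper: "proper_world w" if "w \<in> V" for w
    using S(1)[OF that] by (simp add: ring_with_fakes_def)
  have "2 * card {w \<in> V. ?f w} = card V"
  proof (rule shift_invariant_half[OF V(1) proper V(2)])
    fix w assume w: "w \<in> V"
    note fakes = S(1)[OF w]
    have "length (inputs w) = ring_size w"
      using proper[OF w] by (simp add: proper_world_def)
    then have "length (enlarged_ring w (S w)) = length (committed_inputs \<beta> q w (S w))"
      by (simp add: committed_inputs_def enlarged_ring_def)
    from shift_half[OF q distinct_E[OF fakes] this, of "length (enlarged_ring w (S w)) - 1"]
    show "2 * card {\<delta>. ?f (shift_last \<delta> w)} = CARD('x)"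
      using N_ge_2[OF fakes] w S(3)
      by (simp add: committed_inputs_shift_last[OF fakes S(2)[OF w]])
  qed
  moreover have "(\<Sum>w\<in>V. utility p (outcome (knowledge_sharing_in_a_ring \<beta> q) w (S w))) \<le>
      (\<Sum>w\<in>V. of_bool (?f w))"
  proof (rule sum_mono)
    fix w assume w: "w \<in> V"
    show "utility p (outcome (knowledge_sharing_in_a_ring \<beta> q) w (S w)) \<le> of_bool (?f w)"
      using committed_inputs_value(1)[OF S(1)[OF w] _ S(2)[OF w], of p \<beta> q] utility_le_1
      by (cases "utility p (outcome (knowledge_sharing_in_a_ring \<beta> q) w (S w)) = 0") simp_all
  qed
  moreover have "(\<Sum>w\<in>V. of_bool (?f w)) = real (card {w \<in> V. ?f w})"
    using V(1) by (simp add: sum.If_cases of_bool_def Int_def)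
  ultimately show ?thesis by simp
qed

section \<open>Deviations after the commitment\<close>

lemma names_switch: "0 < r \<Longrightarrow> names (switch r s s') = names s"
  by (simp add: switch_def)

lemma received_switch:
  assumes "0 < r" "t < r"
  shows "received \<Lambda> w (switch r s s') t = received \<Lambda> w s t"
  using assms(2)
proof (induction t)
  case (Suc t)
  have "node_send \<Lambda> w (switch r s s') k (received \<Lambda> w s t k) = node_send \<Lambda> w s k (received \<Lambda> w s t k)" for k
    using assms(1) Suc.prems
    by (simp add: node_send_def seen_from_def enlarged_ring_def names_switch) (simp add: switch_def)
  then show ?case using Suc by simp
qed simp

lemma ring_with_fakes_follow:
  assumes "proper_world w" "names s = names (follow \<Lambda> w)"
  shows "ring_with_fakes w s" "enlarged_ring w s = ids w" "length (names s) < ring_size w" "length (names s) = 1"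
proof -
  show ring: "enlarged_ring w s = ids w"
    using assms by (cases "ids w") (auto simp: proper_world_def enlarged_ring_def follow_def)
  then show "ring_with_fakes w s"
    using assms by (simp add: ring_with_fakes_def proper_world_def follow_def)
  show "length (names s) < ring_size w" "length (names s) = 1"
    using assms by (simp_all add: proper_world_def follow_def)
qed

text \<open>An honest agent counts as a deviator presenting one agent, so the results on deviations
  apply to it.\<close>

lemma commitment_follow:
  assumes "proper_world w" "ring_size w \<le> \<beta>"
  shows "commitment \<beta> q w (follow (knowledge_sharing_in_a_ring \<beta> q) w) 0 = inputs w ! 0"
proof -
  let ?s = "follow (knowledge_sharing_in_a_ring \<beta> q) w" and ?n = "ring_size w"
  have n: "2 \<le> ?n" "distinct (ids w)" "length (inputs w) = ?n"
    using assms(1) by (simp_all add: proper_world_def)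
  note fakes = ring_with_fakes_follow[OF assms(1) refl, of "knowledge_sharing_in_a_ring \<beta> q"]
  \<comment> \<open>With the correct output as preference the honest run succeeds, and in a success
    the commitment is the revealed input.\<close>
  have "utility (q (by_id (ids w) (value_at (ids w) (inputs w)))) (outcome (knowledge_sharing_in_a_ring \<beta> q) w ?s) \<noteq> 0"
    unfolding utility_follow[OF assms] by simp
  from committed_inputs_value(2)[OF fakes(1) this fakes(3), of 0]
  have "commitment \<beta> q w ?s 0 =
      the (node_known \<beta> q w ?s (2 * ?n - 1) (?n - 1) Cw (ids w ! 0, Reveal))"
    unfolding fakes(2,4) by simp
  also have "\<dots> = value_at (ids w) (inputs w) (ids w ! 0)"
    using honest_reveal[OF assms(1), of "?n - 1" "ids w ! 0" \<beta> q] n ring_size_pos[OF assms(1)]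
    by (simp add: node_known_def seen_from_def fakes(2,4))
  also have "\<dots> = inputs w ! 0"
    using n ring_size_pos[OF assms(1)] by (intro value_at_nth) simp_all
  finally show ?thesis .
qed

text \<open>Here \<open>N = n\<close>, and all steps up to round \<open>n - 1\<close> followed the
  protocol, so the commitment to the true input is already made. If the deviation succeeds, the
  correct output is \<open>p\<close> and following succeeds too.\<close>

lemma utility_late_deviation:
  assumes "proper_world w" "ring_size w \<le> \<beta>" "ring_size w \<le> r"
  shows "utility p (outcome (knowledge_sharing_in_a_ring \<beta> q) w
      (switch r (follow (knowledge_sharing_in_a_ring \<beta> q) w) s)) \<le>
    utility p (outcome (knowledge_sharing_in_a_ring \<beta> q) w (follow (knowledge_sharing_in_a_ring \<beta> q) w))"
proof -
  let ?\<Lambda> = "knowledge_sharing_in_a_ring \<beta> q"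
  let ?f = "follow ?\<Lambda> w"
  let ?s = "switch r ?f s" and ?n = "ring_size w"
  have n: "2 \<le> ?n" "length (inputs w) = ?n"
    using assms(1) by (simp_all add: proper_world_def)
  have r: "0 < r" "?n - 1 < r" using n assms(3) by auto
  note fakes = ring_with_fakes_follow[OF assms(1) names_switch[OF r(1)], of ?\<Lambda> s]
  have ring: "enlarged_ring w ?f = ids w" "names ?f = names ?s"
    using ring_with_fakes_follow(2)[OF assms(1) refl] names_switch[OF r(1)] by metis+
  have "commitment \<beta> q w ?s 0 = commitment \<beta> q w ?f 0"
    by (simp add: commitment_def node_known_def seen_from_def fakes(2) ring Let_def received_switch[OF r, simplified])
  then have "commitment \<beta> q w ?s 0 = inputs w ! 0"
    using commitment_follow[OF assms(1,2)] by simp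
  moreover have "inputs w ! 0 # tl (inputs w) = inputs w"
    using n by (cases "inputs w") auto
  ultimately have inputs: "committed_inputs \<beta> q w ?s = inputs w"
    by (simp add: committed_inputs_def fakes(4))
  show ?thesis
  proof (cases "utility p (outcome ?\<Lambda> w ?s) = 0")
    case False
    from committed_inputs_value(1)[OF fakes(1) this fakes(3)]
    show ?thesis
      unfolding utility_follow[OF assms(1,2)] fakes(2) inputs by (simp add: utility_le_1)
  qed (simp add: utility_nonneg)
qed

text \<open>At a round \<open>r < n\<close> the view contains only messages of rounds up to
  \<open>n - 2\<close>. So the worlds that fit a view are closed under shifts.\<close>

lemma view_shift_last:
  assumes "proper_world w" "r < ring_size w"
  shows "view (knowledge_sharing_in_a_ring \<beta> q) r (shift_last \<delta> w) = view (knowledge_sharing_in_a_ring \<beta> q) r w"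
proof -
  let ?\<Lambda> = "knowledge_sharing_in_a_ring \<beta> q"
  have n: "2 \<le> ring_size w" using assms(1) by (simp add: proper_world_def)
  note fakes = ring_with_fakes_follow[OF assms(1) refl, of ?\<Lambda>]
  have "received ?\<Lambda> (shift_last \<delta> w) (follow ?\<Lambda> w) (r - 1) 0 = received ?\<Lambda> w (follow ?\<Lambda> w) (r - 1) 0"
    using assms(2) by (intro received_shift_last[OF fakes(1,3)]) (simp add: fakes(2))
  then show ?thesis
    using n by (simp add: view_def follow_shift_last shift_last_other)
qed

section \<open>Conditional expectations under the prior\<close>

lemma finite_worlds:
  assumes "finite U" "finite Y"
  shows "finite (worlds U Y n :: ('x::finite, 'c::finite, 'y) world set)"
proof -
  let ?L = "\<lambda>A. {xs. set xs \<subseteq> A \<and> length xs = n}"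
  let ?mk = "\<lambda>(i, x, p, c). \<lparr>ids = i, inputs = x, prefs = p, coins = c\<rparr>"
  have "finite (?L U \<times> ?L (UNIV :: 'x set) \<times> ?L Y \<times> ?L (UNIV :: 'c set))"
    using assms by (intro finite_cartesian_product finite_lists_length_eq) simp_all
  moreover have "worlds U Y n \<subseteq> ?mk ` (?L U \<times> ?L (UNIV :: 'x set) \<times> ?L Y \<times> ?L (UNIV :: 'c set))"
  proof
    fix w :: "('x, 'c, 'y) world" assume w: "w \<in> worlds U Y n"
    have "w = ?mk (ids w, inputs w, prefs w, coins w)" by simp
    moreover have "(ids w, inputs w, prefs w, coins w) \<in> ?L U \<times> ?L UNIV \<times> ?L Y \<times> ?L UNIV"
      using w by (simp add: worlds_def)
    ultimately show "w \<in> ?mk ` (?L U \<times> ?L (UNIV :: 'x set) \<times> ?L Y \<times> ?L (UNIV :: 'c set))"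
      by (rule image_eqI)
  qed
  ultimately show ?thesis by (meson finite_surj)
qed

lemma worlds_nonempty:
  assumes "finite U" "n \<le> card U" "Y \<noteq> {}"
  shows "worlds U Y n \<noteq> ({} :: ('x, 'c, 'y) world set)"
proof -
  obtain A where A: "A \<subseteq> U" "card A = n" "finite A"
    using obtain_subset_with_card_n[OF assms(2)] by blast
  obtain xs where "set xs = A" "distinct xs"
    using finite_distinct_list[OF A(3)] by blast
  moreover obtain y where "y \<in> Y" using assms(3) by blast
  ultimately have "\<lparr>ids = xs, inputs = replicate n undefined, prefs = replicate n y,
      coins = replicate n undefined\<rparr> \<in> worlds U Y n"
    using A distinct_card[of xs] by (auto simp: worlds_def)
  then show ?thesis by blast
qed

lemma proper_world_worlds: "w \<in> worlds U Y n \<Longrightarrow> 2 \<le> n \<Longrightarrow> proper_world w"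
  by (simp add: worlds_def proper_world_def)

lemma shift_last_worlds: "shift_last \<delta> w \<in> worlds U Y n \<longleftrightarrow> w \<in> worlds U Y n"
  by (simp add: worlds_def inputs_shift_last coins_shift_last)

lemma set_pmf_prior:
  fixes U :: "nat set" and Y :: "'y set"
  assumes "\<alpha> \<le> \<beta>" "finite U" "finite Y" "Y \<noteq> {}" "\<beta> \<le> card U"
  shows "set_pmf (prior U Y (pmf_of_set {\<alpha>..\<beta>})) =
    (\<Union>n\<in>{\<alpha>..\<beta>}. worlds U Y n :: ('x::finite, 'c::finite, 'y) world set)"
  using assms by (auto simp: prior_def set_pmf_of_set finite_worlds worlds_nonempty)

lemma pmf_prior:
  fixes U :: "nat set" and Y :: "'y set" and w :: "('x::finite, 'c::finite, 'y) world"
  assumes "\<alpha> \<le> \<beta>" "finite U" "finite Y" "Y \<noteq> {}" "\<beta> \<le> card U" "n \<in> {\<alpha>..\<beta>}" "w \<in> worlds U Y n"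
  shows "pmf (prior U Y (pmf_of_set {\<alpha>..\<beta>})) w =
    1 / (card {\<alpha>..\<beta>} * card (worlds U Y n :: ('x, 'c, 'y) world set))"
proof -
  have "pmf (pmf_of_set (worlds U Y m)) w =
      (if m = n then 1 / card (worlds U Y n :: ('x, 'c, 'y) world set) else 0)"
    if "m \<in> {\<alpha>..\<beta>}" for m
  proof -
    have "w \<in> worlds U Y m \<longleftrightarrow> m = n" using assms(7) by (auto simp: worlds_def)
    then show ?thesis
      using that assms by (subst pmf_of_set) (auto simp: finite_worlds worlds_nonempty)
  qed
  then have "(\<Sum>m\<in>{\<alpha>..\<beta>}. pmf (pmf_of_set (worlds U Y m)) w) =
      1 / card (worlds U Y n :: ('x, 'c, 'y) world set)"
    using assms(6) by simp
  then show ?thesis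
    using assms(1) unfolding prior_def pmf_bind by (subst integral_pmf_of_set) simp_all
qed

text \<open>The outer denominator does not depend on \<open>S\<close>, so strategies can be compared
  by the sums over \<open>n\<close> alone. Each world is weighted by one over the number of worlds
  of its size.\<close>

lemma expected_utility_prior:
  fixes U :: "nat set" and Y :: "'y set" and w :: "('x::finite, 'c::finite, 'y) world"
  assumes prems: "\<alpha> \<le> \<beta>" "finite U" "finite Y" "Y \<noteq> {}" "\<beta> \<le> card U"
    and w: "w \<in> set_pmf (prior U Y (pmf_of_set {\<alpha>..\<beta>}))"
  shows "expected_utility (prior U Y (pmf_of_set {\<alpha>..\<beta>})) \<Lambda> r w S =
    (\<Sum>n\<in>{\<alpha>..\<beta>}. (\<Sum>w'\<in>{w' \<in> worlds U Y n. view \<Lambda> r w' = view \<Lambda> r w}.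
        utility (prefs w ! 0) (outcome \<Lambda> w' (S w'))) /
      card (worlds U Y n :: ('x, 'c, 'y) world set)) /
    (card {\<alpha>..\<beta>} * measure_pmf.prob (prior U Y (pmf_of_set {\<alpha>..\<beta>})) {w'. view \<Lambda> r w' = view \<Lambda> r w})"
proof -
  let ?P = "prior U Y (pmf_of_set {\<alpha>..\<beta>}) :: ('x, 'c, 'y) world pmf"
  let ?W = "\<lambda>n. worlds U Y n :: ('x, 'c, 'y) world set"
  let ?B = "{w'. view \<Lambda> r w' = view \<Lambda> r w}"
  let ?u = "\<lambda>w'. utility (prefs w ! 0) (outcome \<Lambda> w' (S w'))"
  let ?Z = "measure_pmf.prob ?P ?B"
  note set_P = set_pmf_prior[OF prems, where 'x='x and 'c='c]
  have fin: "finite (?W n)" for n by (rule finite_worlds[OF prems(2,3)])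
  have ne: "set_pmf ?P \<inter> ?B \<noteq> {}" using w by blast
  have "expected_utility ?P \<Lambda> r w S = measure_pmf.expectation (cond_pmf ?P ?B) ?u"
    by (simp add: expected_utility_def estimate_def)
  also have "\<dots> = (\<Sum>w'\<in>set_pmf ?P. ?u w' * pmf (cond_pmf ?P ?B) w')"
    using fin by (intro integral_measure_pmf_real) (auto simp: set_P set_cond_pmf[OF ne])
  also have "\<dots> = (\<Sum>n\<in>{\<alpha>..\<beta>}. \<Sum>w'\<in>?W n. ?u w' * pmf (cond_pmf ?P ?B) w')"
    unfolding set_P by (rule sum.UNION_disjoint) (auto simp: fin, auto simp: worlds_def)
  also have "\<dots> = (\<Sum>n\<in>{\<alpha>..\<beta>}. (\<Sum>w'\<in>{w' \<in> ?W n. view \<Lambda> r w' = view \<Lambda> r w}. ?u w') /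
      card (?W n) / (card {\<alpha>..\<beta>} * ?Z))"
  proof (rule sum.cong[OF refl])
    fix n assume n: "n \<in> {\<alpha>..\<beta>}"
    have "(\<Sum>w'\<in>?W n. ?u w' * pmf (cond_pmf ?P ?B) w') =
        (\<Sum>w'\<in>?W n. if view \<Lambda> r w' = view \<Lambda> r w then ?u w' / card (?W n) / (card {\<alpha>..\<beta>} * ?Z) else 0)"
      by (rule sum.cong[OF refl]) (simp add: pmf_cond[OF ne] pmf_prior[OF prems n] mult_ac)
    also have "\<dots> = (\<Sum>w'\<in>{w' \<in> ?W n. view \<Lambda> r w' = view \<Lambda> r w}. ?u w' / card (?W n) / (card {\<alpha>..\<beta>} * ?Z))"
      by (rule sum.inter_filter[symmetric, OF fin])
    finally show "(\<Sum>w'\<in>?W n. ?u w' * pmf (cond_pmf ?P ?B) w') =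
        (\<Sum>w'\<in>{w' \<in> ?W n. view \<Lambda> r w' = view \<Lambda> r w}. ?u w') / card (?W n) / (card {\<alpha>..\<beta>} * ?Z)"
      by (simp add: sum_divide_distrib)
  qed
  finally show ?thesis by (simp add: sum_divide_distrib)
qed

section \<open>Deviations at round 0\<close>

lemma transpose_closed: "a \<in> A \<Longrightarrow> b \<in> A \<Longrightarrow> c \<in> A \<Longrightarrow> Transposition.transpose a b c \<in> A"
  by (simp add: Transposition.transpose_def)

text \<open>The map \<open>?g\<close> relabels all nodes at once, which keeps the ids distinct and
  within \<open>U\<close>; translating the inputs back and transposing again inverts it.\<close>

lemma card_worlds_private_le:
  fixes x x' :: "'x::{finite, ab_group_add}" and Y :: "'y set"
  assumes "finite U" "finite Y" "0 < n" "i \<in> U" "i' \<in> U" "p \<in> Y" "p' \<in> Y"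
  shows "card {w \<in> worlds U Y n :: ('x, 'c::finite, 'y) world set. (ids w ! 0, inputs w ! 0, prefs w ! 0) = (i, x, p)}
    \<le> card {w \<in> worlds U Y n :: ('x, 'c, 'y) world set. (ids w ! 0, inputs w ! 0, prefs w ! 0) = (i', x', p')}"
proof (rule card_inj_on_le)
  let ?g = "\<lambda>x x' (w :: ('x, 'c, 'y) world). w\<lparr>ids := map (Transposition.transpose i i') (ids w),
    inputs := map (\<lambda>z. z + (x' - x)) (inputs w), prefs := map (Transposition.transpose p p') (prefs w)\<rparr>"
  show "inj_on (?g x x')
      {w \<in> worlds U Y n. (ids w ! 0, inputs w ! 0, prefs w ! 0) = (i, x, p)}"
    by (rule inj_on_inverseI[where g = "?g x' x"]) (simp add: comp_def)
  show "?g x x' ` {w \<in> worlds U Y n. (ids w ! 0, inputs w ! 0, prefs w ! 0) = (i, x, p)} \<subseteq>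
      {w \<in> worlds U Y n. (ids w ! 0, inputs w ! 0, prefs w ! 0) = (i', x', p')}"
    using assms(3-) by (auto simp: worlds_def distinct_map intro!: transpose_closed)
  show "finite {w \<in> worlds U Y n :: ('x, 'c, 'y) world set. (ids w ! 0, inputs w ! 0, prefs w ! 0) = (i', x', p')}"
    by (rule finite_subset[OF _ finite_worlds[OF assms(1,2)]]) blast
qed

text \<open>By symmetry all private informations are equally frequent. So the proportion of worlds
  of size \<open>n\<close> that fit a given one does not depend on \<open>n\<close>: before Wake-Up
  it says nothing about the ring size.\<close>

lemma card_worlds_private:
  fixes U :: "nat set" and Y :: "'y set" and x :: "'x::{finite, ab_group_add}"
  assumes "finite U" "finite Y" "0 < n" "i \<in> U" "p \<in> Y"
  shows "card (worlds U Y n :: ('x, 'c::finite, 'y) world set) = card U * CARD('x) * card Y *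
    card {w \<in> worlds U Y n :: ('x, 'c, 'y) world set. (ids w ! 0, inputs w ! 0, prefs w ! 0) = (i, x, p)}"
proof -
  let ?W = "worlds U Y n :: ('x, 'c, 'y) world set"
  let ?g = "\<lambda>w :: ('x, 'c, 'y) world. (ids w ! 0, inputs w ! 0, prefs w ! 0)"
  let ?T = "U \<times> (UNIV :: 'x set) \<times> Y"
  have "?g ` ?W \<subseteq> ?T"
    using assms(3) by (auto simp: worlds_def)
  from sum.group[OF finite_worlds[OF assms(1,2)] _ this, of "\<lambda>_. 1 :: nat"]
  have "card ?W = (\<Sum>v\<in>?T. card {w \<in> ?W. ?g w = v})"
    using assms(1,2) by simp
  also have "\<dots> = (\<Sum>v\<in>?T. card {w \<in> ?W. ?g w = (i, x, p)})"
    using assms by (intro sum.cong refl antisym) (auto intro!: card_worlds_private_le simp del: prod.inject)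
  also have "\<dots> = card U * CARD('x) * card Y * card {w \<in> ?W. ?g w = (i, x, p)}"
    by (simp add: card_cartesian_product mult_ac)
  finally show ?thesis .
qed

text \<open>The values 0, 1/2 and 1 bound the chance of success if the duplication is detected, if
  the fake agents are committed, and otherwise. Sizes of the last kind are at most as many as those
  of the first, so the average is at most 1/2.\<close>

lemma duplication_bound:
  fixes \<alpha> \<beta> d :: nat
  assumes "2 \<le> \<alpha>" "0 < d"
  shows "(\<Sum>n\<in>{\<alpha>..\<beta>}. if \<beta> < d + n - 1 then 0 else if d < n then 1 / 2 else 1 :: real) \<le>
    card {\<alpha>..\<beta>} / 2"
proof -
  let ?A0 = "{n \<in> {\<alpha>..\<beta>}. \<beta> < d + n - 1}" and ?A1 = "{n \<in> {\<alpha>..\<beta>}. d + n - 1 \<le> \<beta> \<and> n \<le> d}"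
  have "card ?A1 \<le> card ?A0"
  proof (rule card_inj_on_le[where f = "\<lambda>n. \<beta> + 2 - n"])
    show "inj_on (\<lambda>n. \<beta> + 2 - n) ?A1" by (auto simp: inj_on_def)
    \<comment> \<open>The image is at most \<beta> because of \<open>n \<ge> 2\<close>, exceeds
      \<alpha> because \<open>\<beta> + 2 - n > d \<ge> n\<close>, and is detected because
      \<open>n \<le> d\<close>.\<close>
    show "(\<lambda>n. \<beta> + 2 - n) ` ?A1 \<subseteq> ?A0" using assms by auto
  qed simp
  have "(\<Sum>n\<in>{\<alpha>..\<beta>}. if \<beta> < d + n - 1 then 0 else if d < n then 1 / 2 else 1 :: real) =
      (\<Sum>n\<in>{\<alpha>..\<beta>}. 1 / 2 + (if d + n - 1 \<le> \<beta> \<and> n \<le> d then 1 / 2 else 0) - (if \<beta> < d + n - 1 then 1 / 2 else 0))"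
    by (rule sum.cong) auto
  also have "\<dots> = card {\<alpha>..\<beta>} / 2 + card ?A1 / 2 - card ?A0 / 2"
    by (simp add: sum.distrib sum_subtractf sum.inter_filter[symmetric])
  finally show ?thesis using \<open>card ?A1 \<le> card ?A0\<close> by simp
qed

text \<open>Fake ids lie outside of \<open>U\<close>, so they avoid the real ids in every world with
  the same own id, not only in \<open>w0\<close>.\<close>

lemma ring_with_fakes_admissible:
  assumes "w \<in> worlds U Y n" "2 \<le> n" "admissible U w0 s" "ids w ! 0 = ids w0 ! 0"
  shows "ring_with_fakes w (switch 0 s' s)"
proof -
  obtain i xs where i: "ids w = i # xs"
    using assms(1,2) by (cases "ids w") (auto simp: worlds_def)
  show ?thesis
    using assms i by (auto simp: ring_with_fakes_def proper_world_worlds[OF assms(1,2)] enlarged_ring_def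
        switch_def admissible_def worlds_def)
qed

section \<open>Utility sums over the indistinguishable worlds of one size\<close>

context
  fixes \<alpha> \<beta> :: nat and U :: "nat set" and q :: "'x::{finite, ab_group_add} list \<Rightarrow> 'y"
    and w :: "('x, 'x \<times> 'x, 'y) world" and n :: nat
  assumes prems: "2 \<le> \<alpha>" "finite U" "knowledge_sharing_function 2 q" "n \<in> {\<alpha>..\<beta>}"
    and pref: "prefs w ! 0 \<in> range q"
begin

private abbreviation (input) "protocol \<equiv> knowledge_sharing_in_a_ring \<beta> q"
private abbreviation (input) "indistinguishable r \<equiv> {w' \<in> worlds U (range q) n. view protocol r w' = view protocol r w}"
private abbreviation (input) "u w' s \<equiv> utility (prefs w ! 0) (outcome protocol w' s)"

lemma indistinguishable:
  shows "finite (indistinguishable r)"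
    and "w' \<in> indistinguishable r \<Longrightarrow> proper_world w'"
    and "w' \<in> indistinguishable r \<Longrightarrow> ring_size w' = n"
    and "w' \<in> indistinguishable r \<Longrightarrow> r < n \<Longrightarrow> shift_last \<delta> w' \<in> indistinguishable r"
proof -
  have "finite (range q)"
    using prems(3) by (metis card_eq_0_iff knowledge_sharing_function_def zero_neq_numeral)
  then show "finite (indistinguishable r)"
    by (intro finite_subset[OF _ finite_worlds[OF prems(2)]]) auto
  have n: "2 \<le> n" using prems(1,4) by simp
  show proper: "w' \<in> indistinguishable r \<Longrightarrow> proper_world w'"
    using proper_world_worlds n by blast
  show size: "w' \<in> indistinguishable r \<Longrightarrow> ring_size w' = n"
    by (simp add: worlds_def)
  show "w' \<in> indistinguishable r \<Longrightarrow> r < n \<Longrightarrow> shift_last \<delta> w' \<in> indistinguishable r"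
    using view_shift_last[OF proper, of r] size by (simp add: shift_last_worlds)
qed

lemma sum_utility_follow_indistinguishable:
  assumes "r < n"
  shows "(\<Sum>w'\<in>indistinguishable r. u w' (follow protocol w')) = card (indistinguishable r) / 2"
  using prems(4) assms
  by (intro sum_utility_follow prems pref indistinguishable) (auto simp: indistinguishable(3))

text \<open>From round 1 on no duplication is possible. Before round \<open>n\<close> the deviation
  attains at most one half, the honest value; from round \<open>n\<close> on following is at least
  as good in every single world.\<close>

lemma sum_utility_after_wake_up:
  assumes "0 < r"
  shows "(\<Sum>w'\<in>indistinguishable r. u w' (switch r (follow protocol w') s)) \<le>
    (\<Sum>w'\<in>indistinguishable r. u w' (follow protocol w'))"
proof (cases "r < n")
  case True
  have "2 \<le> n" using prems(1,4) by simp
  have "(\<Sum>w'\<in>indistinguishable r. u w' (switch r (follow protocol w') s)) \<le> card (indistinguishable r) / 2"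
  proof (rule sum_utility_deviation[OF prems(3) pref indistinguishable(1)])
    fix w' \<delta> assume w': "w' \<in> indistinguishable r"
    note fakes = ring_with_fakes_follow[OF indistinguishable(2)[OF w'] names_switch[OF assms]]
    show "ring_with_fakes w' (switch r (follow protocol w') s)"
      "length (names (switch r (follow protocol w') s)) < ring_size w'"
      by (rule fakes)+
    show "switch r (follow protocol (shift_last \<delta> w')) s = switch r (follow protocol w') s"
      using indistinguishable(3)[OF w'] \<open>2 \<le> n\<close> by (simp add: follow_shift_last)
  qed (rule indistinguishable(4)[OF _ True])
  then show ?thesis
    using sum_utility_follow_indistinguishable[OF True] by simp
next
  case False
  show ?thesis
  proof (rule sum_mono)
    fix w' assume w': "w' \<in> indistinguishable r"
    show "u w' (switch r (follow protocol w') s) \<le> u w' (follow protocol w')"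
      using False prems(4) indistinguishable(3)[OF w']
      by (intro utility_late_deviation indistinguishable(2)[OF w']) auto
  qed
qed

text \<open>For a single size the bound may exceed the honest value; the balance comes only from
  summing over \<open>n\<close>.\<close>

lemma sum_utility_before_wake_up:
  assumes "admissible U w s"
  shows "(\<Sum>w'\<in>indistinguishable 0. u w' (switch 0 (follow protocol w') s)) \<le>
    card (indistinguishable 0) *
      (if \<beta> < length (names s) + n - 1 then 0 else if length (names s) < n then 1 / 2 else 1)"
proof -
  have n: "2 \<le> n" using prems(1,4) by simp
  have fakes: "ring_with_fakes w' (switch 0 (follow protocol w') s)" if "w' \<in> indistinguishable 0" for w'
    using that by (intro ring_with_fakes_admissible[OF _ n assms]) (auto simp: view_def)
  have names: "names (switch 0 s' s) = names s" for s'
    by (simp add: switch_def)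
  consider "\<beta> < length (names s) + n - 1" | "length (names s) < n" "\<not> \<beta> < length (names s) + n - 1"
    | "\<not> length (names s) < n" "\<not> \<beta> < length (names s) + n - 1"
    by linarith
  then show ?thesis
  proof cases
    case 1
    have "u w' (switch 0 (follow protocol w') s) = 0" if w': "w' \<in> indistinguishable 0" for w'
      using 1 length_E[OF fakes[OF w']] indistinguishable(3)[OF w']
      by (intro utility_eq_0_if_too_long[OF fakes[OF w']]) (simp add: names)
    then show ?thesis using 1 by simp
  next
    case 2
    have "(\<Sum>w'\<in>indistinguishable 0. u w' (switch 0 (follow protocol w') s)) \<le> card (indistinguishable 0) / 2"
    proof (rule sum_utility_deviation[OF prems(3) pref indistinguishable(1) _ fakes])
      fix w' \<delta> assume w': "w' \<in> indistinguishable 0"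
      show "shift_last \<delta> w' \<in> indistinguishable 0"
        using indistinguishable(4)[OF w'] n by simp
      show "length (names (switch 0 (follow protocol w') s)) < ring_size w'"
        using indistinguishable(3)[OF w'] 2 by (simp add: names)
      show "switch 0 (follow protocol (shift_last \<delta> w')) s = switch 0 (follow protocol w') s"
        using indistinguishable(3)[OF w'] n by (simp add: follow_shift_last)
    qed
    then show ?thesis using 2 by simp
  next
    case 3
    then show ?thesis
      using sum_bounded_above[of "indistinguishable 0" "\<lambda>w'. u w' (switch 0 (follow protocol w') s)" 1]
      by (simp add: utility_le_1)
  qed
qed

end

section \<open>Comparing the expected utilities\<close>

lemma view_0_eq_iff:
  "view \<Lambda> 0 w' = view \<Lambda> 0 w \<longleftrightarrow>
    (ids w' ! 0, inputs w' ! 0, prefs w' ! 0) = (ids w ! 0, inputs w ! 0, prefs w ! 0)"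
  by (auto simp: view_def)

theorem mainTheorem4:
  fixes \<alpha> \<beta> :: nat
    and U :: "nat set"
    and q :: "'x::{finite, ab_group_add} list \<Rightarrow> 'y"
  assumes "2 \<le> \<alpha>" and "\<alpha> \<le> \<beta>"
    and "finite U" and "\<beta> \<le> card U"
    and "knowledge_sharing_function 2 q"
  shows "solves_knowledge_sharing U q (pmf_of_set {\<alpha>..\<beta>}) (knowledge_sharing_in_a_ring \<beta> q) \<and>
    distributed_equilibrium U (range q) (pmf_of_set {\<alpha>..\<beta>}) (knowledge_sharing_in_a_ring \<beta> q)"
proof
  let ?\<Lambda> = "knowledge_sharing_in_a_ring \<beta> q"
  let ?W = "\<lambda>n. worlds U (range q) n :: ('x, 'x \<times> 'x, 'y) world set"
  let ?P = "prior U (range q) (pmf_of_set {\<alpha>..\<beta>}) :: ('x, 'x \<times> 'x, 'y) world pmf"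
  have Y: "finite (range q)" "range q \<noteq> {}"
    using assms(5) by (metis card_eq_0_iff knowledge_sharing_function_def zero_neq_numeral) simp
  note set_P = set_pmf_prior[OF assms(2,3) Y assms(4), where 'x='x and 'c="'x \<times> 'x"]
  show "solves_knowledge_sharing U q (pmf_of_set {\<alpha>..\<beta>}) ?\<Lambda>"
    unfolding solves_knowledge_sharing_def set_P
  proof
    fix w assume "w \<in> (\<Union>n\<in>{\<alpha>..\<beta>}. ?W n)"
    then obtain n where n: "n \<in> {\<alpha>..\<beta>}" "w \<in> ?W n" by blast
    then have "proper_world w" "ring_size w \<le> \<beta>"
      using assms(1) proper_world_worlds[OF n(2)] by (auto simp: worlds_def)
    then show "outcome ?\<Lambda> w (follow ?\<Lambda> w) = replicate (ring_size w) (Some (correct_output q w))"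
      by (rule outcome_follow)
  qed
  show "distributed_equilibrium U (range q) (pmf_of_set {\<alpha>..\<beta>}) ?\<Lambda>"
    unfolding distributed_equilibrium_def
  proof (intro ballI allI impI)
    fix w :: "('x, 'x \<times> 'x, 'y) world" and r :: nat and s :: "('x message, 'y) strategy"
    assume w: "w \<in> set_pmf ?P" and s: "admissible U w s"
    let ?V = "\<lambda>n. {w' \<in> ?W n. view ?\<Lambda> r w' = view ?\<Lambda> r w}"
    let ?u = "\<lambda>w' s. utility (prefs w ! 0) (outcome ?\<Lambda> w' s)"
    let ?fol = "\<lambda>n. (\<Sum>w'\<in>?V n. ?u w' (follow ?\<Lambda> w'))"
    let ?dev = "\<lambda>n. (\<Sum>w'\<in>?V n. ?u w' (switch r (follow ?\<Lambda> w') s))"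
    obtain m where m: "m \<in> {\<alpha>..\<beta>}" "w \<in> ?W m" using w unfolding set_P by blast
    then have "0 < m" using assms(1) by simp
    then have private_values: "ids w ! 0 \<in> U" "prefs w ! 0 \<in> range q"
      using m(2) by (auto simp: worlds_def subset_iff)
    \<comment> \<open>By \<open>expected_utility_prior\<close> both expected utilities are these
      sums divided by the same number.\<close>
    have "(\<Sum>n\<in>{\<alpha>..\<beta>}. ?dev n / card (?W n)) \<le> (\<Sum>n\<in>{\<alpha>..\<beta>}. ?fol n / card (?W n))"
    proof (cases "r = 0")
      case False
      then show ?thesis
        by (auto intro!: sum_mono[of "{\<alpha>..\<beta>}"] divide_right_mono
            sum_utility_after_wake_up[OF assms(1,3,5) _ private_values(2)])
    next
      case True
      let ?d = "length (names s)"
      let ?g = "\<lambda>n. if \<beta> < ?d + n - 1 then 0 else if ?d < n then 1 / 2 else 1 :: real"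
      \<comment> \<open>The proportion of worlds of each size that fit the private information of
        \<open>w\<close>. As it is the same for all \<open>n\<close>, the bounds for the different
        sizes can be averaged with equal weights.\<close>
      define K where "K = 1 / real (card U * CARD('x) * card (range q))"
      have frac: "real (card (?V n)) / card (?W n) = K" if n: "n \<in> {\<alpha>..\<beta>}" for n
      proof -
        have "0 < n" "n \<le> card U" using n assms(1,4) by auto
        have "card (?W n) = card U * CARD('x) * card (range q) * card (?V n)"
          unfolding True view_0_eq_iff
          by (rule card_worlds_private[OF assms(3) Y(1) \<open>0 < n\<close> private_values])
        moreover have "card (?W n) \<noteq> 0"
          by (simp add: finite_worlds worlds_nonempty assms(3) \<open>n \<le> card U\<close> Y)
        ultimately show ?thesis by (simp add: K_def)
      qed
      have "(\<Sum>n\<in>{\<alpha>..\<beta>}. ?dev n / card (?W n)) \<le> (\<Sum>n\<in>{\<alpha>..\<beta>}. K * ?g n)"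
      proof (rule sum_mono)
        fix n assume n: "n \<in> {\<alpha>..\<beta>}"
        have "?dev n \<le> card (?V n) * ?g n"
          unfolding True by (rule sum_utility_before_wake_up[OF assms(1,3,5) n private_values(2) s])
        then have "?dev n / card (?W n) \<le> card (?V n) * ?g n / card (?W n)"
          by (rule divide_right_mono) simp
        also have "\<dots> = K * ?g n"
          unfolding frac[OF n, symmetric] by simp
        finally show "?dev n / card (?W n) \<le> K * ?g n" .
      qed
      also have "\<dots> = K * (\<Sum>n\<in>{\<alpha>..\<beta>}. ?g n)"
        by (simp add: sum_distrib_left)
      also have "\<dots> \<le> K * (card {\<alpha>..\<beta>} / 2)"
        using s by (intro mult_left_mono duplication_bound assms(1)) (simp_all add: admissible_def K_def)
      also have "\<dots> = (\<Sum>n\<in>{\<alpha>..\<beta>}. K / 2)"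
        by simp
      also have "\<dots> = (\<Sum>n\<in>{\<alpha>..\<beta>}. ?fol n / card (?W n))"
      proof (rule sum.cong[OF refl])
        fix n assume n: "n \<in> {\<alpha>..\<beta>}"
        have "?fol n = card (?V n) / 2"
          using n assms(1) True
          by (intro sum_utility_follow_indistinguishable assms private_values(2)) auto
        then show "K / 2 = ?fol n / card (?W n)"
          unfolding frac[OF n, symmetric] by (simp only: divide_divide_eq_left mult.commute)
      qed
      finally show ?thesis .
    qed
    then show "expected_utility ?P ?\<Lambda> r w (\<lambda>w'. switch r (follow ?\<Lambda> w') s)
        \<le> expected_utility ?P ?\<Lambda> r w (follow ?\<Lambda>)"
      unfolding expected_utility_prior[OF assms(2,3) Y assms(4) w]
      by (intro divide_right_mono) auto
  qed
qed

end
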